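(* The map $\Psi:\mathcal{Y}(0)\to P_{\Lambda_0}$ is a bijection and an isomorphism of crystals: it preserves weights, and for every $b\in\mathcal{Y}(0)$ and $i\in\{0,1\}$ one has $\Psi(f_i b)=f_i\Psi(b)$ and $\Psi(e_i b)=e_i\Psi(b)$ (with the convention $\Psi(0)=0$; in particular $f_ib\neq 0$ if and only if $f_i\Psi(b)\neq 0$, and likewise for $e_i$). Here $e_i,f_i$ on the left are the root operators on charged partitions and on the right Littelmann's root operators on LS paths.
   Context: Let $\widehat{\mathfrak{sl}_2}$ be the affine Kac–Moody algebra with simple roots $\alpha_0,\alpha_1$, simple coroots $\alpha_0^\vee,\alpha_1^\vee$, fundamental weights $\Lambda_0,\Lambda_1$, null root $\delta=\alpha_0+\alpha_1$, and Weyl group $W$ generated by the simple reflections $s_0,s_1$. Write $s_j:=s_0$ if $j$ is even and $s_j:=s_1$ if $j$ is odd. For $k\ge 0$ put $w_k=w_k^+:=s_{k-1}\cdots s_1s_0$ (the alternating product of $k$ simple reflections ending on the right with $s_0$; $w_0=1$). The elements $w_k$, $k\ge0$, are the minimal coset representatives of $W/W_{\Lambda_0}$ ($W_{\Lambda_0}$ the stabilizer of $\Lambda_0$), and $w_m>w_n$ in Bruhat order iff $m>n$. Charged partitions. Let $I=\{0,1\}$. A charged partition is a pair $(\pi,j)$ with $\pi$ an integer partition (possibly empty) and $j\in I$ its charge. Its diagram is the Young diagram of $\pi$ (rows numbered from the top, columns from the left) in which the box in row $r$, column $c$ is labelled $j-r+c \pmod 2$. Its weight is $\Lambda_j-n_0\alpha_0-n_1\alpha_1$,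 where $n_i$ is the number of boxes labelled $i$. It is ($2$-)regular if the nonzero parts of $\pi$ are distinct. $\mathcal{Y}(j)$ denotes the set of regular charged partitions of charge $j$. A column is $i$-removable if its bottom box is labelled $i$ and removing it leaves a Young diagram; it is $i$-addable if a box labelled $i$ can be added at its bottom leaving a Young diagram. The $i$-signature is the string of signs obtained by scanning the columns from left to right, including the first empty column (column $\pi_1+1$), writing $+$ for an $i$-addable column, $-$ for an $i$-removable column and nothing otherwise; each sign is remembered together with the column contributing it. A (possibly empty) string of signs is reducible if it has equally many $-$ and $+$ signs and every initial segment has at least as many $-$ as $+$ signs; a substring is a contiguous piece of a string. The reduction of a string is what remains after deleting all signs lying in some reducible substring (it has the form $+\cdots+-\cdots-$). The reduced $i$-signature is the reduction of the $i$-signature. The root operator $e_i$ (resp. $f_i$) removes the bottom box of the column contributing the leftmost $-$ (resp. adds a box labelled $i$ at the bottom of the column contributing the rightmost $+$) of the reduced $i$-signature; if there is no such sign the result is the null element $0$. $\varepsilon_i$ (resp. $\varphi_i$) is the number of $-$ (resp. $+$) signs in the reduced $i$-signature. LS paths. $P_{\Lambda_0}$ is the set of Lakshmibai–Seshadri paths of shape $\Lambda_0$ with Littelmann's crystal structure (root operators $e_i,f_i$, weight = endpoint). A path $(\sigma_1>\dots>\sigma_r;\,0=a_0<a_1<\dots<a_r=1)$ is the piecewise linear map $t\mapsto\sum_{k<j}(a_k-a_{k-1})\sigma_k\Lambda_0+(t-a_{j-1})\sigma_j\Lambda_0$ for $t\in[a_{j-1},a_j]$. The map $\Psi$. For $b=(\mu_1>\mu_2>\dots>\mu_l>0)\in\mathcal{Y}(0)$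 set $m=\mu_1$, $n=l$ (so $m\ge n$), let $\tilde b=(\mu_1-n,\mu_2-(n-1),\dots,\mu_l-1)$, and let its conjugate partition be $(i_{n+1}\ge i_{n+2}\ge\dots\ge i_m)$ (exactly $m-n$ positive parts). Define $\Psi(b)=(w_m>w_{m-1}>\dots>w_{n+1}>w_n;\ 0<\tfrac{i_m}{m}<\tfrac{i_{m-1}}{m-1}<\dots<\tfrac{i_{n+1}}{n+1}<1)$; for $b$ empty, $\Psi(b)=(1;0<1)$. *)

theory Defs
  imports "HOL-Analysis.Analysis"
begin

text \<open>The weight space is spanned by Lambda0, Lambda1, delta; a weight is stored by its
coordinates (c0, c1, d) meaning c0 Lambda0 + c1 Lambda1 + d delta.
Then alpha0 = 2 Lambda0 - 2 Lambda1 + delta and alpha1 = 2 Lambda1 - 2 Lambda0,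
so alpha0 + alpha1 = delta, and the pairing with the simple coroot alpha_i^vee
reads off the Lambda_i coordinate.\<close>

type_synonym weight = "real \<times> real \<times> real"

definition Lam :: "nat \<Rightarrow> weight" where
  "Lam j = (if j = 0 then (1, 0, 0) else (0, 1, 0))"

definition delta :: weight where
  "delta = (0, 0, 1)"

definition alpha :: "nat \<Rightarrow> weight" where
  "alpha i = (if i = 0 then (2, -2, 1) else (-2, 2, 0))"

definition pair :: "weight \<Rightarrow> nat \<Rightarrow> real" where
  "pair v i = (if i = 0 then fst v else fst (snd v))"

definition sref :: "nat \<Rightarrow> weight \<Rightarrow> weight" where
  "sref i v = v - pair v i *\<^sub>R alpha i"

fun wact :: "nat \<Rightarrow> weight \<Rightarrow> weight" where
  "wact 0 v = v"
| "wact (Suc k) v = sref (k mod 2) (wact k v)"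

text \<open>A charged partition is (xs, j): xs is the list of nonzero parts, weakly decreasing,
j the charge.\<close>

type_synonym cpart = "nat list \<times> nat"

definition part :: "nat list \<Rightarrow> nat \<Rightarrow> nat" where
  "part xs r = (if 1 \<le> r \<and> r \<le> length xs then xs ! (r - 1) else 0)"

definition regular :: "nat list \<Rightarrow> bool" where
  "regular xs \<longleftrightarrow> sorted_wrt (>) xs \<and> 0 \<notin> set xs"

definition Y :: "nat \<Rightarrow> cpart set" where
  "Y j = {(xs, j) | xs. regular xs}"

text \<open>label of the box in row r, column c (1-indexed) of a diagram of charge j\<close>
definition label :: "nat \<Rightarrow> nat \<Rightarrow> nat \<Rightarrow> nat" where
  "label j r c = nat ((int j - int r + int c) mod 2)"

definition colh :: "nat list \<Rightarrow> nat \<Rightarrow> nat" where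
  "colh xs c = length (filter (\<lambda>p. c \<le> p) xs)"

definition removable :: "cpart \<Rightarrow> nat \<Rightarrow> nat \<Rightarrow> bool" where
  "removable b i c \<longleftrightarrow> (let xs = fst b; j = snd b; h = colh xs c in
     1 \<le> c \<and> 1 \<le> h \<and> label j h c = i \<and> part xs h = c)"

definition addable :: "cpart \<Rightarrow> nat \<Rightarrow> nat \<Rightarrow> bool" where
  "addable b i c \<longleftrightarrow> (let xs = fst b; j = snd b; h = colh xs c in
     1 \<le> c \<and> label j (h + 1) c = i \<and> part xs (h + 1) = c - 1)"

text \<open>i-signature: list of (column, sign), sign True = +, False = -;
columns scanned from 1 to pi_1 + 1\<close>
definition signature :: "cpart \<Rightarrow> nat \<Rightarrow> (nat \<times> bool) list" where
  "signature b i = concat (map (\<lambda>c. (if addable b i c then [(c, True)] else [])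
                                  @ (if removable b i c then [(c, False)] else []))
                      [1..<part (fst b) 1 + 2])"

definition nplus :: "bool list \<Rightarrow> nat" where
  "nplus s = length (filter (\<lambda>x. x) s)"

definition nminus :: "bool list \<Rightarrow> nat" where
  "nminus s = length (filter Not s)"

definition reducible :: "bool list \<Rightarrow> bool" where
  "reducible s \<longleftrightarrow> nminus s = nplus s \<and>
     (\<forall>k \<le> length s. nplus (take k s) \<le> nminus (take k s))"

definition in_reducible :: "bool list \<Rightarrow> nat \<Rightarrow> bool" where
  "in_reducible s p \<longleftrightarrow> (\<exists>a b. a \<le> p \<and> p < b \<and> b \<le> length s \<and>
       reducible (take (b - a) (drop a s)))"

definition reduction :: "('a \<times> bool) list \<Rightarrow> ('a \<times> bool) list" where
  "reduction s = map (\<lambda>p. s ! p)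
      (filter (\<lambda>p. \<not> in_reducible (map snd s) p) [0..<length s])"

definition reduced_signature :: "cpart \<Rightarrow> nat \<Rightarrow> (nat \<times> bool) list" where
  "reduced_signature b i = reduction (signature b i)"

definition remove_box :: "nat list \<Rightarrow> nat \<Rightarrow> nat list" where
  "remove_box xs c = (let h = colh xs c in filter (\<lambda>p. 0 < p) (xs[h - 1 := c - 1]))"

definition add_box :: "nat list \<Rightarrow> nat \<Rightarrow> nat list" where
  "add_box xs c = (let h = colh xs c in if h < length xs then xs[h := c] else xs @ [c])"

definition ce :: "nat \<Rightarrow> cpart \<Rightarrow> cpart option" where
  "ce i b = (let ms = [c. (c, s) \<leftarrow> reduced_signature b i, \<not> s] in
     if ms = [] then None else Some (remove_box (fst b) (hd ms), snd b))"

definition cf :: "nat \<Rightarrow> cpart \<Rightarrow> cpart option" where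
  "cf i b = (let ps = [c. (c, s) \<leftarrow> reduced_signature b i, s] in
     if ps = [] then None else Some (add_box (fst b) (last ps), snd b))"

definition nboxes :: "cpart \<Rightarrow> nat \<Rightarrow> nat" where
  "nboxes b i = card {(r, c). 1 \<le> r \<and> r \<le> length (fst b) \<and> 1 \<le> c \<and> c \<le> part (fst b) r
                        \<and> label (snd b) r c = i}"

definition cweight :: "cpart \<Rightarrow> weight" where
  "cweight b = Lam (snd b) - real (nboxes b 0) *\<^sub>R alpha 0 - real (nboxes b 1) *\<^sub>R alpha 1"

text \<open>A path is a function [0,1] -> weights, stored as a function on the reals which is 0
outside [0,1]. The LS datum (sigma_1 > ... > sigma_r; 0 = a_0 < ... < a_r = 1) with
sigma_j = w_(ss!(j-1)) is stored as the lists ss (indices k of w_k) and as = [a_0,...,a_r].\<close>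

definition path_fun :: "nat list \<Rightarrow> real list \<Rightarrow> real \<Rightarrow> weight" where
  "path_fun ss as t = (if 0 \<le> t \<and> t \<le> 1 then
     (\<Sum>j<length ss. (min (max t (as ! j)) (as ! (j + 1)) - as ! j) *\<^sub>R wact (ss ! j) (Lam 0))
   else 0)"

text \<open>a-chain for (w_m > w_n): W/W_Lambda0 is the chain w_0 < w_1 < ..., so the chain is
w_m > w_(m-1) > ... > w_n, where w_k = s_beta w_(k-1) with beta = alpha_((k-1) mod 2),
and the condition is a <w_(k-1) Lambda0, beta^vee> in Z.\<close>
definition achain :: "real \<Rightarrow> nat \<Rightarrow> nat \<Rightarrow> bool" where
  "achain a m n \<longleftrightarrow> n < m \<and>
     (\<forall>k. n < k \<and> k \<le> m \<longrightarrow> a * pair (wact (k - 1) (Lam 0)) ((k - 1) mod 2) \<in> \<int>)"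

definition LS_datum :: "nat list \<Rightarrow> real list \<Rightarrow> bool" where
  "LS_datum ss as \<longleftrightarrow> ss \<noteq> [] \<and> length as = length ss + 1 \<and>
     as ! 0 = 0 \<and> last as = 1 \<and> sorted_wrt (<) as \<and> (\<forall>a\<in>set as. a \<in> \<rat>) \<and>
     sorted_wrt (>) ss \<and>
     (\<forall>j. 1 \<le> j \<and> j < length ss \<longrightarrow> achain (as ! j) (ss ! (j - 1)) (ss ! j))"

definition P_Lam0 :: "(real \<Rightarrow> weight) set" where
  "P_Lam0 = {path_fun ss as | ss as. LS_datum ss as}"

definition pweight :: "(real \<Rightarrow> weight) \<Rightarrow> weight" where
  "pweight p = p 1"

definition pe :: "nat \<Rightarrow> (real \<Rightarrow> weight) \<Rightarrow> (real \<Rightarrow> weight) option" where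
  "pe i p = (let h = (\<lambda>t. pair (p t) i); Q = Inf (h ` {0..1}) in
     if Q > -1 then None else
     (let t1 = Inf {t \<in> {0..1}. h t = Q}; t0 = Sup {t \<in> {0..t1}. h t = Q + 1} in
      Some (\<lambda>t. if 0 \<le> t \<and> t \<le> 1 then
                  (if t \<le> t0 then p t
                   else if t \<le> t1 then p t0 + sref i (p t - p t0)
                   else p t + alpha i)
                else 0)))"

definition pf :: "nat \<Rightarrow> (real \<Rightarrow> weight) \<Rightarrow> (real \<Rightarrow> weight) option" where
  "pf i p = (let h = (\<lambda>t. pair (p t) i); Q = Inf (h ` {0..1}) in
     if h 1 - Q < 1 then None else
     (let t0 = Sup {t \<in> {0..1}. h t = Q}; t1 = Inf {t \<in> {t0..1}. h t = Q + 1} in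
      Some (\<lambda>t. if 0 \<le> t \<and> t \<le> 1 then
                  (if t \<le> t0 then p t
                   else if t \<le> t1 then p t0 + sref i (p t - p t0)
                   else p t - alpha i)
                else 0)))"

definition Psi :: "cpart \<Rightarrow> (real \<Rightarrow> weight)" where
  "Psi b = (let xs = fst b; n = length xs; m = (if xs = [] then 0 else hd xs);
               bt = (\<lambda>k. xs ! (k - 1) - (n - k + 1));
               ii = (\<lambda>q. card {k \<in> {1..n}. q - n \<le> bt k}) in
     path_fun (rev [n..<m + 1])
              (0 # map (\<lambda>q. real (ii q) / real q) (rev [n + 1..<m + 1]) @ [1]))"

end

theory Submission
  imports Defs
begin

text \<open>
  All boxes on the antidiagonal r + c = q + 1 of a partition of charge 0 carry the same label
  (q - 1) mod 2. A regular partition is determined by the numbers l q of its boxes on these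
  antidiagonals, and its image under Psi is the path
  t Lambda0 - sum over k of min (k t) (l k) times the simple root with index (k - 1) mod 2:
  the k-th summand stops growing at the break time l k / k, and these times decrease in k.
  Bijectivity and preservation of weights can be read off from this formula.

  For the root operators, fix a colour. The pairing of the path with the coroot has its local
  minima at the break times of the antidiagonals q of that colour. The signature, read from left to
  right, runs through these antidiagonals by increasing q, contributing first the plus signs and then
  the minus signs of each. The height of the signature (plus signs minus minus signs) after the
  plus signs of antidiagonal q equals the final value of the pairing minus its value at the break
  time of q. Hence f changes l q by 1 for the least q at which this height is maximal and e for the
  greatest, on both sides.
\<close>

section \<open>Ladder sequences\<close>

text \<open>Path and signature are never compared with each other directly. Each is compared with
  the integers \<open>peak l q\<close>, whose recursion arises on one side from the slopes of the
  path and on the other from counting columns. What needs care are ties, since several antidiagonals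
  may share a break time and several peaks may share the maximal value. Both sides resolve them
  alike: break times decrease in q, so the last time at which the path is minimal belongs to the
  least q of maximal peak, while columns increase with q, so the rightmost surviving plus belongs to
  the least q too. For e both choices turn into the greatest q. The condition in
  \<open>ladder\<close> lets l grow only while antidiagonals are full. Full antidiagonals have break
  time 1, so their summands never stop growing; the number of those with q > 0 is the number of
  parts, and this encodes the last direction w_n of the path.\<close>

definition ladder :: "(nat \<Rightarrow> nat) \<Rightarrow> bool" where
  "ladder l \<longleftrightarrow> (\<forall>q. l q \<le> q \<and> (l q = q \<or> l (Suc q) \<le> l q)) \<and> finite {q. l q \<noteq> 0}"

text \<open>The value 1 at q = 0 makes the sequence decreasing from the endpoint of the path on.\<close>

definition brk :: "(nat \<Rightarrow> nat) \<Rightarrow> nat \<Rightarrow> real" where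
  "brk l q = (if q = 0 then 1 else real (l q) / real q)"

text \<open>The recursion is forced by the slopes of the path: between the break times of q + 2, q + 1
  and q the pairing first rises with slope q + 2 and then falls with slope q.\<close>

fun peak :: "(nat \<Rightarrow> nat) \<Rightarrow> nat \<Rightarrow> int" where
  "peak l 0 = 0"
| "peak l (Suc 0) = 1 - int (l 1)"
| "peak l (Suc (Suc q)) = peak l q + 2 * int (l (Suc q)) - int (l q) - int (l (Suc (Suc q)))"

lemma ladder_le: "ladder l \<Longrightarrow> l q \<le> q"
  by (simp add: ladder_def)

lemma ladder_0: "ladder l \<Longrightarrow> l 0 = 0"
  using ladder_le[of l 0] by simp

lemma ladder_step: "ladder l \<Longrightarrow> l q < q \<Longrightarrow> l (Suc q) \<le> l q"
  by (metis ladder_def less_irrefl)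

lemma ladder_full_below: "ladder l \<Longrightarrow> l (Suc q) = Suc q \<Longrightarrow> l q = q"
  using ladder_step[of l q] ladder_le[of l q] by linarith

lemma ladder_finite_support:
  assumes "ladder l"
  obtains B where "\<And>q. B < q \<Longrightarrow> l q = 0"
proof -
  have "finite {q. l q \<noteq> 0}" using assms by (simp add: ladder_def)
  then obtain B where "\<forall>q \<in> {q. l q \<noteq> 0}. q \<le> B"
    using finite_nat_set_iff_bounded_le by blast
  then show ?thesis using that by (metis linorder_not_less mem_Collect_eq)
qed

lemma brk_mult: "ladder l \<Longrightarrow> real q * brk l q = real (l q)"
  by (simp add: brk_def ladder_0)

lemma brk_nonneg: "0 \<le> brk l q"
  by (simp add: brk_def)

lemma brk_le_1: "ladder l \<Longrightarrow> brk l q \<le> 1"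
  by (simp add: brk_def ladder_le)

lemma brk_Suc_le:
  assumes "ladder l"
  shows "brk l (Suc q) \<le> brk l q"
proof (cases "l q = q")
  case True
  then have "brk l q = 1" by (simp add: brk_def)
  then show ?thesis using brk_le_1[OF assms] by simp
next
  case False
  then have "l q < q" using ladder_le[OF assms, of q] by simp
  then have "l (Suc q) \<le> l q" "q > 0" using ladder_step[OF assms] by auto
  then show ?thesis by (auto simp: brk_def intro!: frac_le)
qed

lemma brk_antimono: "ladder l \<Longrightarrow> p \<le> q \<Longrightarrow> brk l q \<le> brk l p"
  using brk_Suc_le lift_Suc_antimono_le by blast

lemma brk_less_imp: "ladder l \<Longrightarrow> brk l q < brk l p \<Longrightarrow> p < q"
  using brk_antimono[of l q p] by linarith

text \<open>The conclusion says that there is room to raise l q by one. A strict rise means l (q -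
  2) + l q < 2 l (q - 1). This excludes a full antidiagonal q, because then the two before it are
  full as well and equality holds. If antidiagonal q - 1 is not full, then l (q - 1) \<le> l (q -
  2), so the slack has to sit at q. For q < 2, where there is no earlier peak of the same parity,
  positivity takes this role.\<close>

lemma peak_rise:
  assumes "ladder l" and "0 < peak l q" and "\<And>p. p < q \<Longrightarrow> p mod 2 = q mod 2 \<Longrightarrow> peak l p < peak l q"
  shows "0 < q" and "l q < q" and "l q < l (q - 1) \<or> l (q - 1) = q - 1"
proof -
  show "0 < q" using assms(2) by (cases q) auto
  then consider "q = 1" | p where "q = Suc (Suc p)"
    by (metis One_nat_def not0_implies_Suc gr_implies_not0)
  then have "l q < q \<and> (l q < l (q - 1) \<or> l (q - 1) = q - 1)"
  proof cases
    case 1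
    then show ?thesis using assms(2) ladder_0[OF assms(1)] by auto
  next
    case (2 p)
    have "peak l p < peak l q" using assms(3)[of p] 2 by simp
    then have *: "int (l p) + int (l q) < 2 * int (l (Suc p))" using 2 by simp
    have "l q \<noteq> q"
      using * 2 ladder_full_below[OF assms(1), of "Suc p"] ladder_full_below[OF assms(1), of p]
      by auto
    then have "l q < q" using ladder_le[OF assms(1), of q] by simp
    moreover have "l q < l (Suc p)" if "l (Suc p) \<noteq> Suc p"
    proof -
      have "l (Suc p) < Suc p" using ladder_le[OF assms(1), of "Suc p"] that by simp
      then have "l (Suc p) \<le> l p"
        using ladder_step[OF assms(1), of p] ladder_le[OF assms(1), of p] by (cases "l p = p") auto
      then show ?thesis using * by linarith
    qed
    ultimately show ?thesis using 2 by auto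
  qed
  then show "l q < q" "l q < l (q - 1) \<or> l (q - 1) = q - 1" by auto
qed

text \<open>The counterpart for lowering: after a strict fall one can be taken off l q. If
  antidiagonal q + 1 is full, so is q, and l (q + 2) \<le> q + 2 leaves no fall; otherwise l (q + 2)
  \<le> l (q + 1), and the deficit must come from q.\<close>

lemma peak_fall:
  assumes "ladder l" and "peak l (Suc (Suc q)) < peak l q"
  shows "l (Suc q) < l q"
proof -
  have *: "2 * int (l (Suc q)) < int (l q) + int (l (Suc (Suc q)))" using assms(2) by simp
  show ?thesis
  proof (cases "l (Suc q) = Suc q")
    case True
    then show ?thesis
      using * ladder_full_below[OF assms(1) True] ladder_le[OF assms(1), of "Suc (Suc q)"] by linarith
  next
    case False
    then have "l (Suc q) < Suc q" using ladder_le[OF assms(1), of "Suc q"] by simp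
    then have "l (Suc (Suc q)) \<le> l (Suc q)" using ladder_step[OF assms(1)] by blast
    then show ?thesis using * by linarith
  qed
qed

lemma peak_eventually_const:
  assumes "\<And>q. B < q \<Longrightarrow> l q = 0" and "B < p" "p \<le> q" "p mod 2 = q mod 2"
  shows "peak l q = peak l p"
proof -
  have "peak l (p + 2 * j) = peak l p" for j
    using assms(1,2) by (induction j) auto
  moreover obtain j where "q = p + 2 * j"
    using assms(3,4) by (metis le_add_diff_inverse mod_eq_dvd_iff_nat dvdE add.commute)
  ultimately show ?thesis by simp
qed

lemma peak_attains_max:
  assumes "ladder l" and "c < 2"
  obtains q where "q mod 2 \<noteq> c" "\<And>p. p mod 2 \<noteq> c \<Longrightarrow> peak l p \<le> peak l q"
proof -
  obtain B where B: "\<And>q. B < q \<Longrightarrow> l q = 0" using ladder_finite_support[OF assms(1)] by blast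
  \<comment> \<open>Beyond B the peaks are constant on each parity class, and the bound B + 2
    retains a representative of either class.\<close>
  define S where "S = {q. q \<le> B + 2 \<and> q mod 2 \<noteq> c}"
  have fin: "finite (peak l ` S)" by (simp add: S_def)
  have ne: "peak l ` S \<noteq> {}"
  proof -
    have "1 - c \<in> S" using assms(2) by (auto simp: S_def less_2_cases_iff)
    then show ?thesis by blast
  qed
  obtain q where q: "q \<in> S" "peak l q = Max (peak l ` S)"
    using Max_in[OF fin ne] by (metis imageE)
  have "peak l p \<le> peak l q" if p: "p mod 2 \<noteq> c" for p
  proof -
    have "peak l p \<in> peak l ` S"
    proof (cases "p \<le> B + 2")
      case True then show ?thesis using p by (auto simp: S_def)
    next
      case False
      define r where "r = (if (B + 1) mod 2 = p mod 2 then B + 1 else B + 2)"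
      have "r mod 2 = p mod 2" by (auto simp: r_def) presburger
      then have "peak l p = peak l r" "r \<in> S"
        using peak_eventually_const[of B l r p] B p False by (auto simp: r_def S_def split: if_splits)
      then show ?thesis by blast
    qed
    then show ?thesis using q fin by simp
  qed
  moreover have "q mod 2 \<noteq> c" using q(1) by (simp add: S_def)
  ultimately show ?thesis using that by blast
qed

section \<open>The path of a ladder sequence\<close>

text \<open>The sum ranges over the support of l, which is finite for a ladder sequence, so that no
  bound enters the definition. The value 0 outside the unit interval matches
  \<open>path_fun\<close>.\<close>

definition lpath :: "(nat \<Rightarrow> nat) \<Rightarrow> real \<Rightarrow> weight" where
  "lpath l t = (if 0 \<le> t \<and> t \<le> 1 then
     t *\<^sub>R Lam 0 - (\<Sum>k | l k \<noteq> 0. min (real k * t) (real (l k)) *\<^sub>R alpha (Suc k mod 2)) else 0)"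

lemma lpath_bounded:
  assumes "\<And>q. B < q \<Longrightarrow> l q = 0" "0 \<le> t" "t \<le> 1"
  shows "lpath l t = t *\<^sub>R Lam 0 - (\<Sum>k\<le>B. min (real k * t) (real (l k)) *\<^sub>R alpha (Suc k mod 2))"
proof -
  have "(\<Sum>k | l k \<noteq> 0. min (real k * t) (real (l k)) *\<^sub>R alpha (Suc k mod 2)) =
    (\<Sum>k\<le>B. min (real k * t) (real (l k)) *\<^sub>R alpha (Suc k mod 2))"
  proof (rule sum.mono_neutral_left)
    show "{k. l k \<noteq> 0} \<subseteq> {..B}" using assms(1) by (auto simp: not_less[symmetric])
  qed (use assms(2) in \<open>auto simp: min_absorb2\<close>)
  then show ?thesis using assms by (simp add: lpath_def)
qed

section \<open>Pairing the path with a simple coroot\<close>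

lemma linear_pair: "linear (\<lambda>v. pair v i)"
  by (auto simp: pair_def intro!: linearI)

lemma pair_0: "pair 0 i = 0"
  by (simp add: pair_def)

lemma pair_diff: "pair (v - w) i = pair v i - pair w i"
  using linear_diff[OF linear_pair] by blast

lemma pair_scaleR: "pair (r *\<^sub>R v) i = r * pair v i"
  using linear_scale[OF linear_pair] by simp

lemma pair_sum: "pair (\<Sum>k\<in>A. f k) i = (\<Sum>k\<in>A. pair (f k) i)"
  using linear_sum[OF linear_pair] by blast

lemma pair_Lam0: "c < 2 \<Longrightarrow> pair (Lam 0) c = (if c = 0 then 1 else 0)"
  by (simp add: pair_def Lam_def)

lemma pair_alpha: "c < 2 \<Longrightarrow> pair (alpha (Suc k mod 2)) c = (if k mod 2 = c then -2 else 2)"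
  by (auto simp: pair_def alpha_def less_2_cases_iff mod_Suc)

lemma lpath_pair:
  assumes "\<And>q. B < q \<Longrightarrow> l q = 0" "0 \<le> t" "t \<le> 1" "c < 2"
  shows "pair (lpath l t) c =
    (if c = 0 then t else 0) + (\<Sum>k\<le>B. min (real k * t) (real (l k)) * (if k mod 2 = c then 2 else -2))"
proof -
  have "pair (lpath l t) c = t * pair (Lam 0) c -
    (\<Sum>k\<le>B. min (real k * t) (real (l k)) * pair (alpha (Suc k mod 2)) c)"
    by (simp add: lpath_bounded[OF assms(1-3)] pair_diff pair_scaleR pair_sum)
  then show ?thesis using assms(4)
    by (simp add: pair_Lam0 pair_alpha flip: sum_negf) (auto intro!: sum.cong)
qed

text \<open>These are the two pairings of w_k Lambda_0 with the simple coroots: each new term of the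
  alternating sum turns one of the two forms into the other.\<close>

lemma alternating_slope:
  assumes "c < 2"
  shows "(if c = 0 then 1 else 0) + (\<Sum>j\<le>k. real j * (if j mod 2 = c then 2 else -2)) =
    (if k mod 2 = c then real k + 1 else - real k)"
  using assms by (induction k) (auto simp: less_2_cases_iff mod_Suc)

lemma lpath_segment:
  assumes l: "ladder l" and c: "c < 2" and st: "brk l (Suc k) \<le> s" "s \<le> t" "t \<le> brk l k"
  shows "pair (lpath l t) c - pair (lpath l s) c = (if k mod 2 = c then real k + 1 else - real k) * (t - s)"
proof -
  obtain B where "\<And>q. B < q \<Longrightarrow> l q = 0" using ladder_finite_support[OF l] by blast
  then have B: "\<And>q. max B k < q \<Longrightarrow> l q = 0" by simp
  let ?B = "max B k"
  let ?e = "\<lambda>j. if j mod 2 = c then 2 else -2 :: real"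
  have s: "0 \<le> s" "s \<le> 1" "0 \<le> t" "t \<le> 1"
    using st brk_nonneg[of l "Suc k"] brk_le_1[OF l, of k] by linarith+
  \<comment> \<open>Break times decrease with the index: on this segment the summands j \<le> k have
    not yet reached their cap, and all others have.\<close>
  have tm: "(min (real j * t) (real (l j)) - min (real j * s) (real (l j))) * ?e j =
      (if j \<le> k then real j * ?e j * (t - s) else 0)" for j
  proof (cases "j \<le> k")
    case True
    then have "t \<le> brk l j" using brk_antimono[OF l True] st by simp
    then have "real j * t \<le> real j * brk l j" by (simp add: mult_left_mono)
    then have "real j * t \<le> real (l j)" by (simp add: brk_mult[OF l])
    moreover have "real j * s \<le> real j * t" using st by (simp add: mult_left_mono)
    ultimately have "min (real j * t) (real (l j)) = real j * t" "min (real j * s) (real (l j)) = real j * s"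
      by linarith+
    then show ?thesis using True by (simp add: algebra_simps)
  next
    case False
    then have "brk l j \<le> s" using brk_antimono[OF l, of "Suc k" j] st by simp
    then have "real j * brk l j \<le> real j * s" by (simp add: mult_left_mono)
    then have "real (l j) \<le> real j * s" by (simp add: brk_mult[OF l])
    moreover have "real j * s \<le> real j * t" using st by (simp add: mult_left_mono)
    ultimately have "min (real j * t) (real (l j)) = real (l j)" "min (real j * s) (real (l j)) = real (l j)"
      by linarith+
    then show ?thesis using False by simp
  qed
  have "pair (lpath l t) c - pair (lpath l s) c = (if c = 0 then 1 else 0) * (t - s) +
     (\<Sum>j\<le>?B. (min (real j * t) (real (l j)) - min (real j * s) (real (l j))) * ?e j)"
    using lpath_pair[of ?B l t c, OF _ s(3,4) c] lpath_pair[of ?B l s c, OF _ s(1,2) c] B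
    by (simp add: sum_subtractf left_diff_distrib)
  also have "(\<Sum>j\<le>?B. (min (real j * t) (real (l j)) - min (real j * s) (real (l j))) * ?e j) =
     (\<Sum>j\<le>?B. if j \<le> k then real j * ?e j * (t - s) else 0)"
    using tm by simp
  also have "\<dots> = (\<Sum>j\<le>k. real j * ?e j * (t - s))"
    by (rule sum.mono_neutral_cong_right) auto
  also have "\<dots> = (\<Sum>j\<le>k. real j * ?e j) * (t - s)" by (simp add: sum_distrib_right)
  finally show ?thesis by (simp only: alternating_slope[OF c, of k, symmetric] distrib_right)
qed

text \<open>Rising segments are anchored at their left end, falling ones at their right end. Either
  anchor is the break time of an index of parity other than c, that is, a candidate for a minimum of
  the pairing.\<close>

lemma lpath_up:
  assumes "ladder l" "c < 2" "k mod 2 = c" "brk l (Suc k) \<le> t" "t \<le> brk l k"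
  shows "pair (lpath l t) c = pair (lpath l (brk l (Suc k))) c + real (Suc k) * (t - brk l (Suc k))"
  using lpath_segment[OF assms(1,2) order_refl assms(4,5)] assms(3) by (simp add: algebra_simps)

lemma lpath_down:
  assumes "ladder l" "c < 2" "k mod 2 \<noteq> c" "brk l (Suc k) \<le> t" "t \<le> brk l k"
  shows "pair (lpath l t) c = pair (lpath l (brk l k)) c + real k * (brk l k - t)"
  using lpath_segment[OF assms(1,2,4,5) order_refl] assms(3) by (simp add: algebra_simps)

lemma lpath_peak:
  assumes l: "ladder l" and c: "c < 2" and q: "q mod 2 \<noteq> c"
  shows "pair (lpath l 1) c - pair (lpath l (brk l q)) c = of_int (peak l q)"
  using q
proof (induction q rule: induct_nat_012)
  case 0
  then show ?case by (simp add: brk_def)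
next
  case 1
  then have "c = 0" using c by auto
  moreover have "brk l 0 = 1" "brk l 1 = l 1" by (simp_all add: brk_def)
  ultimately show ?case using lpath_up[OF l c, of 0 1] brk_le_1[OF l, of 1] by simp
next
  case (ge2 q)
  have p: "Suc q mod 2 = c" "q mod 2 \<noteq> c" using ge2.prems c by presburger+
  have "pair (lpath l (brk l (Suc q))) c =
      pair (lpath l (brk l (Suc (Suc q)))) c + real (Suc (Suc q)) * (brk l (Suc q) - brk l (Suc (Suc q)))"
    using lpath_up[OF l c p(1) brk_Suc_le[OF l] order_refl] .
  moreover have "pair (lpath l (brk l (Suc q))) c =
      pair (lpath l (brk l q)) c + real q * (brk l q - brk l (Suc q))"
    using lpath_down[OF l c p(2) order_refl brk_Suc_le[OF l]] .
  \<comment> \<open>The coefficients of the middle break time add up to (q + 2) + q = 2 (q + 1),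
    which gives the factor 2 in the recursion of \<open>peak\<close>.\<close>
  moreover have "real (Suc (Suc q)) * brk l (Suc (Suc q)) = l (Suc (Suc q))"
    "real q * brk l q = l q" "real (Suc q) * brk l (Suc q) = l (Suc q)"
    using brk_mult[OF l] by blast+
  ultimately show ?case using ge2.IH(1)[OF p(2)] by (simp add: algebra_simps)
qed

section \<open>Covering the unit interval by segments, and the minimum of the pairing\<close>

lemma brk_eventually_0:
  assumes "ladder l"
  shows "\<exists>k>0. \<forall>j\<ge>k. l j = 0 \<and> brk l j = 0"
proof -
  obtain B where "\<And>q. B < q \<Longrightarrow> l q = 0" using ladder_finite_support[OF assms] by blast
  then have "\<forall>j\<ge>Suc B. l j = 0 \<and> brk l j = 0" by (auto simp: brk_def Suc_le_eq)
  then show ?thesis by blast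
qed

text \<open>Break times may coincide, so a least index picks a segment containing t. Two half-open
  versions are provided: for e, times before the minimum are compared with the right end of their
  segment and need strictness there; for f, times after it are compared with the left end.\<close>

lemma brk_cover_right:
  assumes "ladder l" "0 \<le> t" "t < 1"
  obtains k where "brk l (Suc k) \<le> t" "t < brk l k"
proof -
  obtain k0 where k0: "0 < k0" "\<forall>j\<ge>k0. brk l j = 0" using brk_eventually_0[OF assms(1)] by blast
  then have ex: "brk l (Suc k0) \<le> t" using assms by simp
  define k where "k = (LEAST k. brk l (Suc k) \<le> t)"
  have k: "brk l (Suc k) \<le> t" unfolding k_def using ex by (rule LeastI)
  have "t < brk l k"
  proof (cases k)
    case 0 then show ?thesis using assms by (simp add: brk_def)
  next
    case (Suc k')
    then have "\<not> brk l (Suc k') \<le> t" using not_less_Least[of k' "\<lambda>k. brk l (Suc k) \<le> t"] k_def by simp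
    then show ?thesis using Suc by simp
  qed
  then show ?thesis using k that by blast
qed

lemma brk_cover_left:
  assumes "ladder l" "0 < t" "t \<le> 1"
  obtains k where "brk l (Suc k) < t" "t \<le> brk l k"
proof -
  obtain k0 where k0: "0 < k0" "\<forall>j\<ge>k0. brk l j = 0" using brk_eventually_0[OF assms(1)] by blast
  then have ex: "brk l (Suc k0) < t" using assms by simp
  define k where "k = (LEAST k. brk l (Suc k) < t)"
  have k: "brk l (Suc k) < t" unfolding k_def using ex by (rule LeastI)
  have "t \<le> brk l k"
  proof (cases k)
    case 0 then show ?thesis using assms by (simp add: brk_def)
  next
    case (Suc k')
    then have "\<not> brk l (Suc k') < t" using not_less_Least[of k' "\<lambda>k. brk l (Suc k) < t"] k_def by simp
    then show ?thesis using Suc by simp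
  qed
  then show ?thesis using k that by blast
qed

lemma lpath_outside: "\<not> (0 \<le> t \<and> t \<le> 1) \<Longrightarrow> lpath l t = 0"
  by (simp only: lpath_def if_False)

lemma lpath_0: "lpath l 0 = 0"
  by (simp add: lpath_def)

lemma lpath_ge_max_peak:
  assumes l: "ladder l" and c: "c < 2" and max: "\<And>p. p mod 2 \<noteq> c \<Longrightarrow> peak l p \<le> K"
    and t: "0 \<le> t" "t \<le> 1"
  shows "pair (lpath l 1) c - of_int K \<le> pair (lpath l t) c"
proof -
  have pk: "pair (lpath l 1) c - of_int K \<le> pair (lpath l (brk l q)) c" if "q mod 2 \<noteq> c" for q
    using lpath_peak[OF l c that] max[OF that] by simp
  show ?thesis
  proof (cases "t = 0")
    case True
    \<comment> \<open>Time 0 is the break time of every late index, and one of two consecutive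
      indices has the required parity.\<close>
    obtain k where k: "\<forall>j\<ge>k. brk l j = 0" using brk_eventually_0[OF l] by blast
    have "k mod 2 \<noteq> c \<or> Suc k mod 2 \<noteq> c" by presburger
    then obtain j where "k \<le> j" "j mod 2 \<noteq> c" by (meson le_SucI order_refl)
    then show ?thesis using pk[of j] k True by simp
  next
    case False
    then obtain k where k: "brk l (Suc k) < t" "t \<le> brk l k"
      using brk_cover_left[OF l, of t] t by auto
    show ?thesis
    proof (cases "k mod 2 = c")
      case True
      then have "Suc k mod 2 \<noteq> c" by (auto simp: mod_Suc)
      moreover have "0 \<le> real (Suc k) * (t - brk l (Suc k))" using k by simp
      ultimately show ?thesis using pk[of "Suc k"] lpath_up[OF l c True, of t] k by linarith
    next
      case False
      moreover have "0 \<le> real k * (brk l k - t)" using k by simp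
      ultimately show ?thesis using pk[of k] lpath_down[OF l c False, of t] k by linarith
    qed
  qed
qed

lemma lpath_Inf:
  assumes l: "ladder l" and c: "c < 2" and q: "q mod 2 \<noteq> c"
    and max: "\<And>p. p mod 2 \<noteq> c \<Longrightarrow> peak l p \<le> peak l q"
  shows "Inf ((\<lambda>t. pair (lpath l t) c) ` {0..1}) = pair (lpath l (brk l q)) c"
proof (rule cInf_eq_minimum)
  show "pair (lpath l (brk l q)) c \<in> (\<lambda>t. pair (lpath l t) c) ` {0..1}"
    using brk_nonneg brk_le_1[OF l] by force
  fix x assume "x \<in> (\<lambda>t. pair (lpath l t) c) ` {0..1}"
  then show "pair (lpath l (brk l q)) c \<le> x"
    using lpath_ge_max_peak[OF l c max] lpath_peak[OF l c q] by fastforce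
qed

lemma lpath_upd:
  assumes l: "ladder l" and t: "0 \<le> t" "t \<le> 1"
  shows "lpath (l(q := v)) t =
    lpath l t - (min (real q * t) (real v) - min (real q * t) (real (l q))) *\<^sub>R alpha (Suc q mod 2)"
proof -
  obtain B where B: "\<And>q. B < q \<Longrightarrow> l q = 0" using ladder_finite_support[OF l] by blast
  let ?B = "max B q"
  let ?g = "\<lambda>w k. min (real k * t) (real w) *\<^sub>R alpha (Suc k mod 2)"
  have 1: "lpath l t = t *\<^sub>R Lam 0 - (\<Sum>k\<le>?B. ?g (l k) k)"
    by (rule lpath_bounded) (use B t in auto)
  have 2: "lpath (l(q := v)) t = t *\<^sub>R Lam 0 - (\<Sum>k\<le>?B. ?g ((l(q := v)) k) k)"
    by (rule lpath_bounded) (use B t in auto)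
  have "(\<Sum>k\<le>?B. ?g ((l(q := v)) k) k) = ?g v q + (\<Sum>k\<in>{..?B} - {q}. ?g ((l(q := v)) k) k)"
    by (subst sum.remove[of _ q]) auto
  also have "(\<Sum>k\<in>{..?B} - {q}. ?g ((l(q := v)) k) k) = (\<Sum>k\<in>{..?B} - {q}. ?g (l k) k)"
    by (rule sum.cong) auto
  also have "\<dots> = (\<Sum>k\<le>?B. ?g (l k) k) - ?g (l q) q"
    by (subst sum.remove[of "{..?B}" q]) auto
  finally show ?thesis unfolding 1 2 by (simp add: scaleR_left_diff_distrib)
qed

section \<open>Littelmann's root operators on ladder paths\<close>

lemma pf_lpath_None:
  assumes l: "ladder l" and c: "c < 2" and "\<And>p. p mod 2 \<noteq> c \<Longrightarrow> peak l p \<le> 0"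
  shows "pf c (lpath l) = None"
proof -
  obtain q where q: "q mod 2 \<noteq> c" "\<And>p. p mod 2 \<noteq> c \<Longrightarrow> peak l p \<le> peak l q"
    using peak_attains_max[OF l c] by blast
  have "pair (lpath l 1) c - pair (lpath l (brk l q)) c < 1"
    using lpath_peak[OF l c q(1)] assms(3)[OF q(1)] by simp
  then show ?thesis using lpath_Inf[OF l c q] by (simp add: pf_def)
qed

text \<open>Littelmann's t0 is the break time of q, and t1 is the break time that q has after l q is
  raised by one. In between the pairing has slope q, so the reflection subtracts q (t - t0) times
  the simple root, which is exactly the additional growth of the q-th summand.\<close>

lemma pf_lpath_Some:
  assumes l: "ladder l" and c: "c < 2" and q: "q mod 2 \<noteq> c"
    and max: "\<And>p. p mod 2 \<noteq> c \<Longrightarrow> peak l p \<le> peak l q"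
    and least: "\<And>p. p mod 2 \<noteq> c \<Longrightarrow> p < q \<Longrightarrow> peak l p < peak l q"
    and pos: "0 < peak l q"
  shows "pf c (lpath l) = Some (lpath (l(q := l q + 1)))"
proof -
  have mod_eq: "p mod 2 \<noteq> c" if "p mod 2 = q mod 2" for p using that q by simp
  note rise = peak_rise[OF l pos least[OF mod_eq]]
  define h where "h = (\<lambda>t. pair (lpath l t) c)"
  define t0 where "t0 = brk l q"
  define t1 where "t1 = (real (l q) + 1) / real q"
  define Q where "Q = h t0"
  have q0: "0 < q" using rise by blast
  obtain k where k: "q = Suc k" using q0 gr0_implies_Suc by blast
  have kc: "k mod 2 = c" using q k c by (auto simp: mod_Suc split: if_splits)
  have colour: "Suc q mod 2 = c" using q c by (auto simp: mod_Suc split: if_splits)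
  have t0: "real q * t0 = l q" "0 \<le> t0" "t0 \<le> 1"
    unfolding t0_def using brk_mult[OF l] brk_nonneg brk_le_1[OF l] by blast+
  have t1: "real q * t1 = l q + 1" "t0 < t1"
    using q0 by (auto simp: t1_def t0_def brk_def divide_strict_right_mono)
  \<comment> \<open>The room provided by \<open>peak_rise\<close> makes the rising segment to the
    right of t0 long enough to contain t1.\<close>
  have t1_le: "t1 \<le> brk l k"
  proof (cases "l k = k")
    case True
    then have "brk l k = 1" by (simp add: brk_def)
    then show ?thesis using rise(2) q0 by (simp add: t1_def)
  next
    case False
    then have "l q + 1 \<le> l k" using rise k by auto
    moreover have "0 < k" using False ladder_0[OF l] by (cases k) auto
    ultimately show ?thesis using k by (auto simp: t1_def brk_def intro!: frac_le)
  qed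
  have t1_1: "t1 \<le> 1" using t1_le brk_le_1[OF l] order_trans by blast
  have rise_seg: "h t = Q + real q * (t - t0)" if "t0 \<le> t" "t \<le> t1" for t
    using lpath_up[OF l c kc, of t] that t1_le by (simp add: h_def Q_def t0_def k)
  \<comment> \<open>Later times lie in segments of index below q. Their anchors have values above Q
    by the choice of the least q, except for the segment anchored at t0 itself, along which h rises
    at once.\<close>
  have above: "Q < h t" if t: "t0 < t" "t \<le> 1" for t
  proof -
    obtain j where j: "brk l (Suc j) < t" "t \<le> brk l j"
      using brk_cover_left[OF l _ t(2)] t t0 by auto
    then have "brk l q < brk l j" using t t0_def by linarith
    then have jq: "j < q" by (rule brk_less_imp[OF l])
    have low: "Q < h (brk l p)" if "p mod 2 \<noteq> c" "p < q" for p
    proof -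
      have "real_of_int (peak l p) < real_of_int (peak l q)" using least[OF that] by simp
      then show ?thesis
        using lpath_peak[OF l c that(1)] lpath_peak[OF l c q] by (simp add: h_def Q_def t0_def)
    qed
    show ?thesis
    proof (cases "j mod 2 = c")
      case True
      have s: "0 < real (Suc j) * (t - brk l (Suc j))" using j by simp
      have u: "h t = h (brk l (Suc j)) + real (Suc j) * (t - brk l (Suc j))"
        using lpath_up[OF l c True, of t] j by (simp add: h_def)
      show ?thesis
      proof (cases "Suc j = q")
        case True then show ?thesis using u s by (simp add: Q_def t0_def)
      next
        case False
        have "Suc j mod 2 \<noteq> c" using True by (auto simp: mod_Suc)
        then show ?thesis using low[of "Suc j"] u s jq False by simp
      qed
    next
      case False
      have "0 \<le> real j * (brk l j - t)" using j by simp
      moreover have "h t = h (brk l j) + real j * (brk l j - t)"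
        using lpath_down[OF l c False, of t] j by (simp add: h_def)
      ultimately show ?thesis using low[OF False jq] by linarith
    qed
  qed
  have Inf_eq: "Inf (h ` {0..1}) = Q"
    using lpath_Inf[OF l c q max] by (simp add: h_def Q_def t0_def)
  have Sup_eq: "Sup {t \<in> {0..1}. h t = Q} = t0"
  proof (rule cSup_eq_maximum)
    show "t0 \<in> {t \<in> {0..1}. h t = Q}" using t0 by (simp add: Q_def)
    show "t \<le> t0" if "t \<in> {t \<in> {0..1}. h t = Q}" for t
      using that above[of t] by (cases "t \<le> t0") auto
  qed
  have ht1: "h t1 = Q + 1" using rise_seg[of t1] t1 t0 by (simp add: right_diff_distrib)
  have Inf_t1: "Inf {t \<in> {t0..1}. h t = Q + 1} = t1"
  proof (rule cInf_eq_minimum)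
    show "t1 \<in> {t \<in> {t0..1}. h t = Q + 1}" using ht1 t1 t1_1 by simp
    fix t assume t: "t \<in> {t \<in> {t0..1}. h t = Q + 1}"
    show "t1 \<le> t"
    proof (rule ccontr)
      assume "\<not> t1 \<le> t"
      then have "h t = Q + real q * (t - t0)" "real q * (t - t0) < real q * (t1 - t0)"
        using t rise_seg q0 by auto
      then show False using t t1 t0 by (simp add: right_diff_distrib)
    qed
  qed
  have big: "\<not> h 1 - Q < 1"
    using lpath_peak[OF l c q] pos by (simp add: h_def Q_def t0_def)
  have "pf c (lpath l) = Some (\<lambda>t. if 0 \<le> t \<and> t \<le> 1 then
                  (if t \<le> t0 then lpath l t
                   else if t \<le> t1 then lpath l t0 + sref c (lpath l t - lpath l t0)
                   else lpath l t - alpha c)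
                else 0)"
    unfolding pf_def Let_def h_def[symmetric] Inf_eq Sup_eq Inf_t1 using big by simp
  also have "\<dots> = Some (lpath (l(q := l q + 1)))"
  proof (intro arg_cong[where f = Some] ext)
    fix t
    show "(if 0 \<le> t \<and> t \<le> 1 then
                  (if t \<le> t0 then lpath l t
                   else if t \<le> t1 then lpath l t0 + sref c (lpath l t - lpath l t0)
                   else lpath l t - alpha c)
                else 0) = lpath (l(q := l q + 1)) t"
    proof (cases "0 \<le> t \<and> t \<le> 1")
      case False then show ?thesis
        using lpath_outside[OF False, of "l(q := l q + 1)"] by (simp only: if_False)
    next
      case True
      then have u: "lpath (l(q := l q + 1)) t =
        lpath l t - (min (real q * t) (real (l q) + 1) - min (real q * t) (real (l q))) *\<^sub>R alpha c"
        using lpath_upd[OF l, of t q "l q + 1"] by (simp add: colour add.commute)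
      \<comment> \<open>Before t0 neither version of the q-th summand is capped, between t0 and t1
        only the old one is, and after t1 both are.\<close>
      consider "t \<le> t0" | "t0 < t" "t \<le> t1" | "t1 < t" by linarith
      then show ?thesis
      proof cases
        case 1
        then have "real q * t \<le> real q * t0" by (simp add: mult_left_mono)
        then show ?thesis using True 1 u t0 by (simp add: min_def)
      next
        case 2
        then have "real q * t0 \<le> real q * t" "real q * t \<le> real q * t1" by (simp_all add: mult_left_mono)
        then have "min (real q * t) (real (l q) + 1) - min (real q * t) (real (l q)) = real q * (t - t0)"
          using t0 t1 by (simp add: min_def right_diff_distrib)
        moreover have "pair (lpath l t - lpath l t0) c = real q * (t - t0)"
          using rise_seg[of t] 2 by (simp add: pair_diff h_def Q_def)
        ultimately show ?thesis using True 2 u by (simp add: sref_def)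
      next
        case 3
        then have "real q * t1 \<le> real q * t" by (simp add: mult_left_mono)
        then have "min (real q * t) (real (l q) + 1) - min (real q * t) (real (l q)) = 1"
          using t1 by linarith
        then show ?thesis using True 3 u t1 by simp
      qed
    qed
  qed
  finally show ?thesis .
qed

text \<open>An empty antidiagonal has break time 0, so the minimum of the pairing is its value 0 at
  the start of the path.\<close>

lemma pe_lpath_None:
  assumes l: "ladder l" and c: "c < 2" and q: "q mod 2 \<noteq> c"
    and max: "\<And>p. p mod 2 \<noteq> c \<Longrightarrow> peak l p \<le> peak l q" and q0: "0 < q" "l q = 0"
  shows "pe c (lpath l) = None"
proof -
  have "brk l q = 0" using q0 by (simp add: brk_def)
  then show ?thesis using lpath_Inf[OF l c q max] by (simp add: pe_def lpath_0 pair_0)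
qed

text \<open>Mirror image of the case of f: here t1 is the break time of q, t0 is the one after
  lowering l q, and the pairing has slope -q between them.\<close>

lemma pe_lpath_Some:
  assumes l: "ladder l" and c: "c < 2" and q: "q mod 2 \<noteq> c"
    and max: "\<And>p. p mod 2 \<noteq> c \<Longrightarrow> peak l p \<le> peak l q"
    and greatest: "\<And>p. p mod 2 \<noteq> c \<Longrightarrow> q < p \<Longrightarrow> peak l p < peak l q"
  shows "pe c (lpath l) = Some (lpath (l(q := l q - 1)))"
proof -
  have fall: "l (Suc q) < l q"
    using peak_fall[OF l] greatest[of "Suc (Suc q)"] q by simp
  define h where "h = (\<lambda>t. pair (lpath l t) c)"
  define t1 where "t1 = brk l q"
  define t0 where "t0 = (real (l q) - 1) / real q"
  define Q where "Q = h t1"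
  have q0: "0 < q" using fall ladder_0[OF l] by (cases q) auto
  have colour: "Suc q mod 2 = c" using q c by (auto simp: mod_Suc split: if_splits)
  have t1: "real q * t1 = l q" "0 \<le> t1" "t1 \<le> 1"
    unfolding t1_def using brk_mult[OF l] brk_nonneg brk_le_1[OF l] by blast+
  have t0: "real q * t0 = real (l q) - 1" "t0 < t1"
    using q0 by (auto simp: t1_def t0_def brk_def divide_strict_right_mono)
  \<comment> \<open>Here l (q + 1) \<le> l q - 1 enters; replacing the denominator q + 1 by q only
    enlarges the bound.\<close>
  have t0_ge: "brk l (Suc q) \<le> t0"
  proof -
    have "real (l (Suc q)) / real (Suc q) \<le> real (l (Suc q)) / real q"
      using q0 by (intro divide_left_mono) auto
    also have "\<dots> \<le> t0" unfolding t0_def using fall q0 by (intro divide_right_mono) auto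
    finally show ?thesis by (simp add: brk_def)
  qed
  have t0_0: "0 \<le> t0" using t0_ge brk_nonneg order_trans by blast
  have fall_seg: "h t = Q + real q * (t1 - t)" if "t0 \<le> t" "t \<le> t1" for t
    using lpath_down[OF l c q, of t] that t0_ge by (simp add: h_def Q_def t1_def)
  have above: "Q < h t" if t: "0 \<le> t" "t < t1" for t
  proof -
    obtain j where j: "brk l (Suc j) \<le> t" "t < brk l j"
      using brk_cover_right[OF l t(1)] t t1 by auto
    then have "brk l (Suc j) < brk l q" using t t1_def by linarith
    then have jq: "q \<le> j" using brk_less_imp[OF l, of "Suc j" q] by simp
    have low: "Q < h (brk l p)" if "p mod 2 \<noteq> c" "q < p" for p
    proof -
      have "real_of_int (peak l p) < real_of_int (peak l q)" using greatest[OF that] by simp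
      then show ?thesis
        using lpath_peak[OF l c that(1)] lpath_peak[OF l c q] by (simp add: h_def Q_def t1_def)
    qed
    show ?thesis
    proof (cases "j mod 2 = c")
      case True
      have "0 \<le> real (Suc j) * (t - brk l (Suc j))" using j by simp
      moreover have "h t = h (brk l (Suc j)) + real (Suc j) * (t - brk l (Suc j))"
        using lpath_up[OF l c True, of t] j by (simp add: h_def)
      moreover have "Suc j mod 2 \<noteq> c" using True by (auto simp: mod_Suc)
      ultimately show ?thesis using low[of "Suc j"] jq by simp
    next
      case False
      have s: "0 < real j * (brk l j - t)" using j jq q0 by simp
      have u: "h t = h (brk l j) + real j * (brk l j - t)"
        using lpath_down[OF l c False, of t] j by (simp add: h_def)
      show ?thesis
      proof (cases "j = q")
        case True then show ?thesis using u s by (simp add: Q_def t1_def)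
      next
        case neq: False
        then show ?thesis using low[OF False] u s jq by simp
      qed
    qed
  qed
  have Inf_eq: "Inf (h ` {0..1}) = Q"
    using lpath_Inf[OF l c q max] by (simp add: h_def Q_def t1_def)
  have Inf_t1: "Inf {t \<in> {0..1}. h t = Q} = t1"
  proof (rule cInf_eq_minimum)
    show "t1 \<in> {t \<in> {0..1}. h t = Q}" using t1 by (simp add: Q_def)
    show "t1 \<le> t" if "t \<in> {t \<in> {0..1}. h t = Q}" for t
      using that above[of t] by (cases "t1 \<le> t") auto
  qed
  have ht0: "h t0 = Q + 1" using fall_seg[of t0] t1 t0 by (simp add: right_diff_distrib)
  have Sup_eq: "Sup {t \<in> {0..t1}. h t = Q + 1} = t0"
  proof (rule cSup_eq_maximum)
    show "t0 \<in> {t \<in> {0..t1}. h t = Q + 1}" using ht0 t0 t0_0 by simp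
    fix t assume t: "t \<in> {t \<in> {0..t1}. h t = Q + 1}"
    show "t \<le> t0"
    proof (rule ccontr)
      assume "\<not> t \<le> t0"
      then have "h t = Q + real q * (t1 - t)" "real q * (t1 - t) < real q * (t1 - t0)"
        using t fall_seg q0 by auto
      then show False using t t1 t0 by (simp add: right_diff_distrib)
    qed
  qed
  have big: "\<not> Q > -1"
  proof -
    obtain k where k: "\<forall>j\<ge>k. brk l j = 0" using brk_eventually_0[OF l] by blast
    \<comment> \<open>An index beyond q, of the same parity, with break time 0. Its peak is the
      final value of the pairing and lies strictly below the maximal peak; since peaks are integers,
      Q is at most -1.\<close>
    define p where "p = q + 2 * Suc k"
    have p: "p mod 2 \<noteq> c" "q < p" "brk l p = 0" using q k by (simp_all add: p_def)
    have "peak l p + 1 \<le> peak l q" using greatest[OF p(1,2)] by linarith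
    then have "real_of_int (peak l p) + 1 \<le> real_of_int (peak l q)" by linarith
    then show ?thesis
      using lpath_peak[OF l c p(1)] lpath_peak[OF l c q] p(3)
      by (simp add: h_def Q_def t1_def lpath_0 pair_0)
  qed
  have "pe c (lpath l) = Some (\<lambda>t. if 0 \<le> t \<and> t \<le> 1 then
                  (if t \<le> t0 then lpath l t
                   else if t \<le> t1 then lpath l t0 + sref c (lpath l t - lpath l t0)
                   else lpath l t + alpha c)
                else 0)"
    unfolding pe_def Let_def h_def[symmetric] Inf_eq Sup_eq Inf_t1 using big by simp
  also have "\<dots> = Some (lpath (l(q := l q - 1)))"
  proof (intro arg_cong[where f = Some] ext)
    fix t
    show "(if 0 \<le> t \<and> t \<le> 1 then
                  (if t \<le> t0 then lpath l t
                   else if t \<le> t1 then lpath l t0 + sref c (lpath l t - lpath l t0)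
                   else lpath l t + alpha c)
                else 0) = lpath (l(q := l q - 1)) t"
    proof (cases "0 \<le> t \<and> t \<le> 1")
      case False then show ?thesis
        using lpath_outside[OF False, of "l(q := l q - 1)"] by (simp only: if_False)
    next
      case True
      have "real (l q - 1) = real (l q) - 1" using fall by simp
      then have u: "lpath (l(q := l q - 1)) t =
        lpath l t - (min (real q * t) (real (l q) - 1) - min (real q * t) (real (l q))) *\<^sub>R alpha c"
        using lpath_upd[OF l, of t q "l q - 1"] True by (simp only: colour)
      consider "t \<le> t0" | "t0 < t" "t \<le> t1" | "t1 < t" by linarith
      then show ?thesis
      proof cases
        case 1
        then have "real q * t \<le> real q * t0" by (simp add: mult_left_mono)
        then show ?thesis using True 1 u t0 by (simp add: min_def)
      next
        case 2
        then have "real q * t0 \<le> real q * t" "real q * t \<le> real q * t1" by (simp_all add: mult_left_mono)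
        then have "min (real q * t) (real (l q) - 1) - min (real q * t) (real (l q)) = real q * (t0 - t)"
          using t0 t1 by (simp add: min_def right_diff_distrib)
        moreover have "pair (lpath l t - lpath l t0) c = real q * (t0 - t)"
          using fall_seg[of t] ht0 2 t0 t1 by (simp add: pair_diff h_def right_diff_distrib)
        ultimately show ?thesis using True 2 u by (simp add: sref_def)
      next
        case 3
        then have "real q * t1 \<le> real q * t" by (simp add: mult_left_mono)
        then have "min (real q * t) (real (l q) - 1) - min (real q * t) (real (l q)) = - 1"
          using t1 by linarith
        then show ?thesis using True 3 u t0 by simp
      qed
    qed
  qed
  finally show ?thesis .
qed

section \<open>Regular partitions as ladder sequences\<close>

text \<open>Row k meets antidiagonal q in column q + 1 - k, so q < part xs k + k says that this box
  belongs to the diagram. Rows past the last one have length 0 and are not counted because k \<le>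
  q.\<close>

definition lad :: "nat list \<Rightarrow> nat \<Rightarrow> nat" where
  "lad xs q = card {k \<in> {1..q}. q < part xs k + k}"

lemma downward_closed_eq_interval:
  fixes S :: "nat set"
  assumes "finite S" "0 \<notin> S" "\<And>j k. k \<in> S \<Longrightarrow> 1 \<le> j \<Longrightarrow> j \<le> k \<Longrightarrow> j \<in> S"
  shows "S = {1..card S}"
proof (cases "S = {}")
  case False
  have *: "S = {1..Max S}"
  proof (intro equalityI subsetI)
    fix j assume j: "j \<in> S"
    then have "j \<noteq> 0" using assms(2) by metis
    then show "j \<in> {1..Max S}" using Max_ge[OF assms(1) j] by simp
  next
    fix j assume "j \<in> {1..Max S}"
    then show "j \<in> S" using assms(3)[OF Max_in[OF assms(1) False]] by simp
  qed
  have "card S = card {1..Max S}" using * by (rule arg_cong)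
  then have "card S = Max S" by simp
  then show ?thesis using * by argo
qed simp

lemma part_Suc: "k < length xs \<Longrightarrow> part xs (Suc k) = xs ! k"
  by (simp add: part_def)

lemma part_beyond: "length xs < k \<Longrightarrow> part xs k = 0"
  by (simp add: part_def)

lemma regular_iff_nth:
  "regular xs \<longleftrightarrow> (\<forall>i. Suc i < length xs \<longrightarrow> xs ! Suc i < xs ! i) \<and> (\<forall>i < length xs. 0 < xs ! i)"
  by (auto simp: regular_def sorted_wrt_iff_nth_Suc_transp transp_def in_set_conv_nth)

lemma regularI:
  assumes "\<And>i. Suc i < length xs \<Longrightarrow> xs ! Suc i < xs ! i" "\<And>i. i < length xs \<Longrightarrow> 0 < xs ! i"
  shows "regular xs"
  unfolding regular_iff_nth using assms by blast

lemma regular_nth_less: "regular xs \<Longrightarrow> Suc i < length xs \<Longrightarrow> xs ! Suc i < xs ! i"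
  by (simp add: regular_iff_nth)

lemma regular_nth_pos: "regular xs \<Longrightarrow> i < length xs \<Longrightarrow> 0 < xs ! i"
  by (simp add: regular_iff_nth)

lemma part_pos_iff: "regular xs \<Longrightarrow> 0 < part xs (Suc k) \<longleftrightarrow> k < length xs"
  using regular_nth_pos[of xs k] by (cases "k < length xs") (simp_all add: part_Suc part_beyond)

lemma part_Suc_le:
  assumes "regular xs" "1 \<le> k" "0 < part xs (Suc k)"
  shows "part xs (Suc k) + Suc k \<le> part xs k + k"
proof -
  have "k < length xs" using assms(3) by (auto simp: part_def split: if_splits)
  moreover obtain i where "k = Suc i" using assms(2) by (cases k) auto
  ultimately show ?thesis using regular_nth_less[OF assms(1), of i] by (simp add: part_Suc)
qed

text \<open>Distinct parts drop by at least one per row, which makes up for the growth of k. Past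
  the last row the part stays 0 and the sum grows, hence the positivity assumption.\<close>

lemma part_diag_antimono:
  assumes "regular xs" "1 \<le> j" "j \<le> k" "0 < part xs k"
  shows "part xs k + k \<le> part xs j + j"
  using assms(3,4)
proof (induction k rule: dec_induct)
  case (step k)
  then have "part xs (Suc k) + Suc k \<le> part xs k + k" using part_Suc_le[OF assms(1)] assms(2) by simp
  moreover have "0 < part xs k" using calculation step.prems by simp
  ultimately show ?case using step.IH by simp
qed simp

lemma part_antimono:
  assumes "regular xs" "1 \<le> j" "j \<le> k"
  shows "part xs k \<le> part xs j"
  using part_diag_antimono[OF assms] assms(3) by (cases "part xs k = 0") auto

text \<open>By the monotonicity of part + row, the rows that meet an antidiagonal form an initial
  segment, so their number determines which ones they are.\<close>

lemma le_lad_iff: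
  assumes "regular xs" "1 \<le> k" "k \<le> q"
  shows "k \<le> lad xs q \<longleftrightarrow> q < part xs k + k"
proof -
  let ?S = "{k \<in> {1..q}. q < part xs k + k}"
  have "?S = {1..card ?S}"
  proof (rule downward_closed_eq_interval)
    fix j k assume "k \<in> ?S" "1 \<le> j" "j \<le> k"
    then show "j \<in> ?S" using part_diag_antimono[OF assms(1), of j k] by auto
  qed auto
  then have "k \<in> ?S \<longleftrightarrow> k \<in> {1..lad xs q}" unfolding lad_def by blast
  then show ?thesis using assms by auto
qed

lemma le_colh_iff:
  assumes "regular xs" "1 \<le> k" "1 \<le> c"
  shows "k \<le> colh xs c \<longleftrightarrow> c \<le> part xs k"
proof -
  let ?S = "{k \<in> {1..length xs}. c \<le> part xs k}"
  have "colh xs c = card {i. i < length xs \<and> c \<le> xs ! i}"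
    by (simp add: colh_def length_filter_conv_card)
  also have "\<dots> = card ?S"
  proof (rule bij_betw_same_card[of Suc], rule bij_betw_imageI)
    show "Suc ` {i. i < length xs \<and> c \<le> xs ! i} = ?S"
    proof (intro set_eqI iffI)
      fix k assume "k \<in> ?S"
      then show "k \<in> Suc ` {i. i < length xs \<and> c \<le> xs ! i}"
        by (cases k) (auto simp: part_Suc)
    qed (auto simp: part_Suc)
  qed simp
  finally have card: "colh xs c = card ?S" .
  have "?S = {1..card ?S}"
  proof (rule downward_closed_eq_interval)
    fix j k assume "k \<in> ?S" "1 \<le> j" "j \<le> k"
    then show "j \<in> ?S" using part_antimono[OF assms(1), of j k] by auto
  qed auto
  then have "k \<in> ?S \<longleftrightarrow> k \<in> {1..colh xs c}" unfolding card by blast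
  moreover have "k \<le> length xs" if "c \<le> part xs k"
    using that assms(3) by (auto simp: part_def split: if_splits)
  ultimately show ?thesis using assms by auto
qed

lemma lad_le: "lad xs q \<le> q"
proof -
  have "lad xs q \<le> card {1..q}" unfolding lad_def by (rule card_mono) auto
  then show ?thesis by simp
qed

text \<open>The bridge from antidiagonals to columns. Boxes fill an antidiagonal from the top, hence
  from the right, so its empty places are the first q - lad xs q columns; and column c is empty
  there when it ends above row q + 1 - c.\<close>

lemma le_colfill_iff:
  assumes "regular xs" "1 \<le> c"
  shows "c \<le> q - lad xs q \<longleftrightarrow> colh xs c + c \<le> q"
proof (cases "c \<le> q")
  case True
  let ?k = "q - c + 1"
  have "?k \<le> lad xs q \<longleftrightarrow> q < part xs ?k + ?k" using le_lad_iff[OF assms(1), of ?k q] True assms(2) by simp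
  moreover have "?k \<le> colh xs c \<longleftrightarrow> c \<le> part xs ?k" using le_colh_iff[OF assms(1) _ assms(2), of ?k] by simp
  ultimately show ?thesis using True lad_le[of xs q] assms(2) by linarith
qed auto

lemma lad_0_iff:
  assumes "regular xs" "1 \<le> q"
  shows "lad xs q = 0 \<longleftrightarrow> part xs 1 < q"
  using le_lad_iff[OF assms(1), of 1 q] assms(2) by auto

lemma ladder_lad:
  assumes "regular xs"
  shows "ladder (lad xs)"
proof -
  have "lad xs q = q \<or> lad xs (Suc q) \<le> lad xs q" for q
  proof (rule ccontr)
    assume a: "\<not> (lad xs q = q \<or> lad xs (Suc q) \<le> lad xs q)"
    \<comment> \<open>The first row that antidiagonal q misses: if antidiagonal q + 1 met it, the
      row would be long enough to meet antidiagonal q as well.\<close>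
    let ?k = "Suc (lad xs q)"
    have "?k \<le> q" using a lad_le[of xs q] by simp
    then have "\<not> q < part xs ?k + ?k" using le_lad_iff[OF assms, of ?k q] by simp
    moreover have "Suc q < part xs ?k + ?k" using le_lad_iff[OF assms, of ?k "Suc q"] a \<open>?k \<le> q\<close> by simp
    ultimately show False by simp
  qed
  moreover have "{q. lad xs q \<noteq> 0} \<subseteq> {..part xs 1}"
  proof
    fix q assume "q \<in> {q. lad xs q \<noteq> 0}"
    then show "q \<in> {..part xs 1}" using lad_0_iff[OF assms, of q] by (cases "q = 0") auto
  qed
  ultimately show ?thesis unfolding ladder_def using lad_le finite_subset by blast
qed

lemma lad_full:
  assumes "regular xs" "q \<le> length xs"
  shows "lad xs q = q"
proof (cases "q = 0")
  case False
  then have "0 < part xs q" using part_pos_iff[OF assms(1), of "q - 1"] assms(2) by simp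
  then have "q \<le> lad xs q" using le_lad_iff[OF assms(1), of q q] False by simp
  then show ?thesis using lad_le[of xs q] by simp
qed (simp add: lad_def)

lemma lad_not_full:
  assumes "regular xs" "length xs < q"
  shows "lad xs q < q"
proof -
  have "\<not> q \<le> lad xs q"
    using le_lad_iff[OF assms(1), of q q] part_beyond[OF assms(2)] assms(2) by simp
  then show ?thesis by simp
qed

lemma list_eq_iff_part:
  assumes "regular xs" "regular ys" "\<And>k. 1 \<le> k \<Longrightarrow> part xs k = part ys k"
  shows "xs = ys"
proof -
  have "k < length xs \<longleftrightarrow> k < length ys" for k
  proof -
    have "part xs (Suc k) = part ys (Suc k)" using assms(3) by simp
    then show ?thesis
      unfolding part_pos_iff[OF assms(1), symmetric] part_pos_iff[OF assms(2), symmetric] by (rule arg_cong)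
  qed
  from this[of "length xs"] this[of "length ys"] have "length xs = length ys" by simp
  then show ?thesis
  proof (rule nth_equalityI)
    fix i assume "i < length xs"
    then show "xs ! i = ys ! i" using assms(3)[of "Suc i"] \<open>length xs = length ys\<close> by (simp add: part_Suc)
  qed
qed

text \<open>The box in row k and column c lies on antidiagonal k + c - 1, so the counts decide for
  every box whether it is present.\<close>

lemma lad_inj:
  assumes "regular xs" "regular ys" "lad xs = lad ys"
  shows "xs = ys"
proof (rule list_eq_iff_part[OF assms(1,2)])
  fix k :: nat assume k: "1 \<le> k"
  have "c \<le> part xs k \<longleftrightarrow> c \<le> part ys k" if "1 \<le> c" for c
  proof -
    have "k \<le> k + c - 1" using that by simp
    then have "k + c - 1 < part xs k + k \<longleftrightarrow> k + c - 1 < part ys k + k"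
      using le_lad_iff[OF assms(1) k] le_lad_iff[OF assms(2) k] assms(3) by simp
    then show ?thesis using that by linarith
  qed
  from this[of "part xs k"] this[of "part ys k"] show "part xs k = part ys k"
    by (cases "part xs k = 0"; cases "part ys k = 0") auto
qed

text \<open>The new box, in row r and column c, touches antidiagonal r + c - 1 only. Phrased through
  \<open>part\<close>, this serves for adding a box and, with the partitions exchanged, for removing
  one.\<close>

lemma lad_part_increment:
  assumes "part ys = (part xs)(r := c)" "part xs r = c - 1" "1 \<le> r" "1 \<le> c"
  shows "lad ys = (lad xs)(r + c - 1 := lad xs (r + c - 1) + 1)"
proof
  fix q
  let ?S = "{k \<in> {1..q}. q < part xs k + k}"
  show "lad ys q = ((lad xs)(r + c - 1 := lad xs (r + c - 1) + 1)) q"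
  proof (cases "q = r + c - 1")
    case True
    have "{k \<in> {1..q}. q < part ys k + k} = insert r ?S"
      using assms True by (auto split: if_splits)
    moreover have "r \<notin> ?S" using assms True by auto
    ultimately show ?thesis using True by (simp add: lad_def)
  next
    case False
    have "{k \<in> {1..q}. q < part ys k + k} = ?S"
      using assms False by (auto split: if_splits)
    then show ?thesis using False by (simp add: lad_def)
  qed
qed

section \<open>Adding and removing a box on a given antidiagonal\<close>

lemma part_list_update:
  "h < length xs \<Longrightarrow> part (xs[h := c]) = (part xs)(Suc h := c)"
  by (auto simp: part_def fun_eq_iff nth_list_update)

lemma part_snoc: "part (xs @ [c]) = (part xs)(Suc (length xs) := c)"
  by (auto simp: part_def fun_eq_iff nth_append)

text \<open>With the top lad xs q rows occupied, the next box of antidiagonal q belongs to row lad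
  xs q + 1, hence to column q - lad xs q. The second hypothesis supplies its left neighbour, unless
  it opens a new row in column 1.\<close>

lemma add_box_ladder:
  assumes r: "regular xs" and q: "lad xs q < q" "lad xs q < lad xs (q - 1) \<or> lad xs (q - 1) = q - 1"
  shows "regular (add_box xs (q - lad xs q))"
    and "lad (add_box xs (q - lad xs q)) = (lad xs)(q := lad xs q + 1)"
proof -
  define c where "c = q - lad xs q"
  define h where "h = lad xs q"
  have c1: "1 \<le> c" using q by (simp add: c_def)
  have E: "d \<le> p - lad xs p \<longleftrightarrow> colh xs d + d \<le> p" if "1 \<le> d" for d p
    using le_colfill_iff[OF r that] .
  have "colh xs c + c \<le> q" using E[OF c1, of q] by (simp add: c_def)
  moreover have "\<not> colh xs c + c \<le> q - 1" using E[OF c1, of "q - 1"] q by (auto simp: c_def)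
  ultimately have col: "colh xs c = h" using q by (simp add: c_def h_def)
  have C: "k \<le> colh xs d \<longleftrightarrow> d \<le> part xs k" if "1 \<le> k" "1 \<le> d" for k d
    using le_colh_iff[OF r that] .
  have "c - 1 \<le> part xs (h + 1)"
  proof (cases "c = 1")
    case False
    then have c2: "1 \<le> c - 1" using c1 by simp
    have "\<not> colh xs (c - 1) + (c - 1) \<le> q - 1" using E[OF c2, of "q - 1"] q c2 by (auto simp: c_def)
    then show ?thesis using C[of "h + 1" "c - 1"] c2 q by (auto simp: c_def h_def)
  qed simp
  moreover have "\<not> c \<le> part xs (h + 1)" using C[of "h + 1" c] c1 col by simp
  ultimately have part: "part xs (h + 1) = c - 1" by simp
  \<comment> \<open>Column c + 1 is not among the empty places of antidiagonal q, so the row above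
    the new box is longer than c. This keeps the parts distinct.\<close>
  have "\<not> colh xs (c + 1) + (c + 1) \<le> q" using E[of "c + 1" q] by (simp add: c_def)
  then have "h \<le> colh xs (c + 1)" using q by (simp add: c_def h_def)
  then have above: "c < part xs h" if "1 \<le> h" using C[OF that, of "c + 1"] by simp
  have "h \<le> length xs" using col by (metis colh_def length_filter_le)
  then have pu: "part (add_box xs c) = (part xs)(Suc h := c)"
    by (auto simp: add_box_def col Let_def part_list_update part_snoc)
  then show "lad (add_box xs (q - lad xs q)) = (lad xs)(q := lad xs q + 1)"
    using lad_part_increment[OF pu] part c1 q by (simp add: c_def h_def)
  show "regular (add_box xs (q - lad xs q))"
  proof (cases "h < length xs")
    case True
    have xh: "xs ! h = c - 1" using part True by (simp add: part_Suc)
    have ab: "c < xs ! i" if "h = Suc i" for i using above that True by (simp add: part_Suc)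
    have "regular (xs[h := c])"
    proof (rule regularI)
      fix i assume i: "Suc i < length (xs[h := c])"
      then show "xs[h := c] ! Suc i < xs[h := c] ! i"
        using regular_nth_less[OF r, of i] ab[of i] xh c1 True by (auto simp: nth_list_update)
    next
      fix i assume "i < length (xs[h := c])"
      then show "0 < xs[h := c] ! i" using regular_nth_pos[OF r, of i] c1 True by (auto simp: nth_list_update)
    qed
    then show ?thesis using True by (simp add: add_box_def col Let_def flip: c_def)
  next
    case False
    then have h: "h = length xs" using \<open>h \<le> length xs\<close> by simp
    have ab: "c < xs ! i" if "h = Suc i" for i using above that h by (simp add: part_Suc)
    have "regular (xs @ [c])"
    proof (rule regularI)
      fix i assume i: "Suc i < length (xs @ [c])"
      then show "(xs @ [c]) ! Suc i < (xs @ [c]) ! i"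
        using regular_nth_less[OF r, of i] ab[of i] h by (cases "Suc i = h") (auto simp: nth_append)
    next
      fix i assume "i < length (xs @ [c])"
      then show "0 < (xs @ [c]) ! i" using regular_nth_pos[OF r, of i] c1 by (auto simp: nth_append)
    qed
    then show ?thesis using h by (simp add: add_box_def col Let_def flip: c_def)
  qed
qed

text \<open>The lowest box of antidiagonal q is in row lad xs q and column q + 1 - lad xs q. Its
  right neighbour would lie on antidiagonal q + 1, which has fewer boxes, so the row ends with this
  box.\<close>

lemma remove_box_ladder:
  assumes r: "regular xs" and q: "lad xs (Suc q) < lad xs q"
  shows "regular (remove_box xs (Suc (q - lad xs q)))"
    and "lad (remove_box xs (Suc (q - lad xs q))) = (lad xs)(q := lad xs q - 1)"
proof -
  define c where "c = Suc (q - lad xs q)"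
  define h where "h = lad xs q"
  have c1: "1 \<le> c" by (simp add: c_def)
  have hq: "1 \<le> h" "h \<le> q" using q lad_le[of xs q] by (auto simp: h_def)
  have E: "d \<le> p - lad xs p \<longleftrightarrow> colh xs d + d \<le> p" if "1 \<le> d" for d p
    using le_colfill_iff[OF r that] .
  have "\<not> colh xs c + c \<le> q" using E[OF c1, of q] by (simp add: c_def)
  moreover have c': "c + 1 \<le> Suc q - lad xs (Suc q)" using q hq by (simp add: c_def h_def)
  moreover have "colh xs c + c \<le> Suc q" using E[OF c1, of "Suc q"] c' by simp
  ultimately have col: "colh xs c = h" using hq by (simp add: c_def h_def)
  have C: "k \<le> colh xs d \<longleftrightarrow> d \<le> part xs k" if "1 \<le> k" "1 \<le> d" for k d
    using le_colh_iff[OF r that] .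
  have "colh xs (c + 1) + (c + 1) \<le> Suc q" using E[of "c + 1" "Suc q"] c' by simp
  then have "\<not> h \<le> colh xs (c + 1)" using hq by (simp add: c_def h_def)
  then have "\<not> c + 1 \<le> part xs h" using C[OF hq(1)] by simp
  moreover have "c \<le> part xs h" using C[OF hq(1) c1] col by simp
  ultimately have part: "part xs h = c" by simp
  \<comment> \<open>Antidiagonal q stops at row h, so row h + 1 has no box in column c - 1 and stays
    shorter than the shortened row.\<close>
  have below: "part xs (h + 1) < c - 1" if "c \<noteq> 1"
  proof -
    have c2: "1 \<le> c - 1" using that c1 by simp
    have "colh xs (c - 1) + (c - 1) \<le> q" using E[OF c2, of q] by (simp add: c_def)
    then show ?thesis using C[of "h + 1" "c - 1"] c2 hq by (auto simp: c_def h_def)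
  qed
  have hl: "h \<le> length xs" using col by (metis colh_def length_filter_le)
  obtain i where i: "h = Suc i" using hq by (cases h) auto
  have xi: "xs ! i = c" "i < length xs" using part i hl by (auto simp: part_Suc)
  have reg: "regular (remove_box xs c) \<and> part (remove_box xs c) = (part xs)(h := c - 1)"
  proof (cases "c = 1")
    case True
    \<comment> \<open>In column 1 the removed box is the whole last row, and the filter in
      \<open>remove_box\<close> deletes the resulting part 0.\<close>
    have "\<not> 1 \<le> part xs (h + 1)" using C[of "h + 1" 1] col True by simp
    then have "length xs = h" using hl part_pos_iff[OF r, of h] by simp
    then obtain ys where ys: "xs = ys @ [1]" "length ys = i"
      using xi i True by (metis append_butlast_last_id last_conv_nth length_butlast diff_Suc_1 list.size(3) less_nat_zero_code)
    have "remove_box xs c = filter (\<lambda>p. 0 < p) (ys @ [0])"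
      using True i col ys by (simp add: remove_box_def Let_def list_update_append)
    also have "\<dots> = ys" using r ys by (auto simp: regular_def filter_id_conv intro!: gr0I)
    finally have rb: "remove_box xs c = ys" .
    have "regular ys" using r ys by (simp add: regular_def sorted_wrt_append)
    moreover have "part ys = (part xs)(h := c - 1)"
      using ys i True by (auto simp: part_def fun_eq_iff nth_append)
    ultimately show ?thesis using rb by simp
  next
    case False
    have "0 \<notin> set (xs[i := c - 1])"
      using r False c1 set_update_subset_insert[of xs i "c - 1"] by (auto simp: regular_def)
    then have "filter (\<lambda>p. 0 < p) (xs[i := c - 1]) = xs[i := c - 1]"
      by (auto simp: filter_id_conv intro: gr0I)
    then have rb: "remove_box xs c = xs[i := c - 1]"
      using col i by (simp add: remove_box_def Let_def)
    have "xs ! Suc i < c - 1" if "Suc i < length xs" using below[OF False] that i by (simp add: part_Suc)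
    note below' = this
    have "regular (xs[i := c - 1])"
    proof (rule regularI)
      fix j assume j: "Suc j < length (xs[i := c - 1])"
      then show "xs[i := c - 1] ! Suc j < xs[i := c - 1] ! j"
        using regular_nth_less[OF r, of j] below' xi by (auto simp: nth_list_update)
    next
      fix j assume "j < length (xs[i := c - 1])"
      then show "0 < xs[i := c - 1] ! j"
        using regular_nth_pos[OF r, of j] False c1 xi by (auto simp: nth_list_update)
    qed
    then show ?thesis using rb part_list_update[OF xi(2)] i by simp
  qed
  then show "regular (remove_box xs (Suc (q - lad xs q)))" by (simp add: c_def)
  have "part xs = (part (remove_box xs c))(h := c)" using reg part by auto
  from lad_part_increment[OF this] have
    "lad xs = (lad (remove_box xs c))(h + c - 1 := lad (remove_box xs c) (h + c - 1) + 1)"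
    using reg hq c1 by simp
  moreover have "h + c - 1 = q" using hq by (simp add: c_def h_def)
  ultimately have *: "lad xs = (lad (remove_box xs c))(q := lad (remove_box xs c) q + 1)" by simp
  have "lad (remove_box xs c) = (lad xs)(q := lad xs q - 1)"
    by (subst (1 2) *) (simp add: fun_eq_iff)
  then show "lad (remove_box xs (Suc (q - lad xs q))) = (lad xs)(q := lad xs q - 1)"
    by (simp add: c_def)
qed

text \<open>Induction on the number of boxes. On the last nonempty antidiagonal the count can be
  lowered without violating the ladder condition, because everything beyond is 0; the box is then
  added to the partition obtained by induction.\<close>

lemma ladder_imp_lad:
  assumes "ladder l"
  shows "\<exists>xs. regular xs \<and> lad xs = l"
  using assms
proof (induction "\<Sum>q | l q \<noteq> 0. l q" arbitrary: l rule: less_induct)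
  case less
  have fin: "finite {q. l q \<noteq> 0}" using less.prems by (simp add: ladder_def)
  show ?case
  proof (cases "{q. l q \<noteq> 0} = {}")
    case True
    then have "l = (\<lambda>_. 0)" by auto
    moreover have "lad [] = (\<lambda>_. 0)" by (auto simp: lad_def part_def)
    ultimately show ?thesis by (intro exI[of _ "[]"]) (simp add: regular_def)
  next
    case False
    define q where "q = Max {q. l q \<noteq> 0}"
    have q: "l q \<noteq> 0" using Max_in[OF fin False] by (simp add: q_def)
    have above: "l p = 0" if "q < p" for p using Max_ge[OF fin, of p] that by (auto simp: q_def)
    define l' where "l' = l(q := l q - 1)"
    have L: "l p \<le> p" "l p = p \<or> l (Suc p) \<le> l p" for p using less.prems by (auto simp: ladder_def)
    have fin': "finite {p. l' p \<noteq> 0}" by (rule finite_subset[OF _ fin]) (auto simp: l'_def)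
    have "l' p \<le> p \<and> (l' p = p \<or> l' (Suc p) \<le> l' p)" for p
      using L[of p] above[of "Suc q"] by (auto simp: l'_def)
    then have lad': "ladder l'" using fin' by (simp add: ladder_def)
    have "(\<Sum>p | l' p \<noteq> 0. l' p) = (\<Sum>p | l p \<noteq> 0. l' p)"
      by (rule sum.mono_neutral_left[OF fin]) (auto simp: l'_def)
    also have "\<dots> < (\<Sum>p | l p \<noteq> 0. l p)"
      by (rule sum_strict_mono_ex1[OF fin]) (use q in \<open>auto simp: l'_def\<close>)
    finally obtain xs where xs: "regular xs" "lad xs = l'" using less.hyps lad' by blast
    obtain k where k: "q = Suc k" using q L(1)[of q] by (cases q) auto
    have "l' q < q" using q L(1)[of q] by (simp add: l'_def)
    moreover have "l' q < l' (q - 1) \<or> l' (q - 1) = q - 1" using L(2)[of k] q k by (auto simp: l'_def)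
    ultimately have "regular (add_box xs (q - l' q))" "lad (add_box xs (q - l' q)) = l'(q := l' q + 1)"
      using add_box_ladder[OF xs(1), of q] xs(2) by auto
    moreover have "l'(q := l' q + 1) = l" using q by (auto simp: l'_def)
    ultimately show ?thesis by metis
  qed
qed

section \<open>LS paths\<close>

text \<open>Both coordinates are needed at once in the induction: reflecting negates k + 1 and adds
  twice that number to the other coordinate -k.\<close>

lemma pair_wact:
  "pair (wact k (Lam 0)) (k mod 2) = real k + 1 \<and> pair (wact k (Lam 0)) (Suc k mod 2) = - real k"
proof (induction k)
  case 0
  show ?case by (simp add: pair_def Lam_def)
next
  case (Suc k)
  have a: "pair (alpha (k mod 2)) (Suc k mod 2) = -2" "pair (alpha (k mod 2)) (k mod 2) = 2"
    by (auto simp: pair_def alpha_def mod_Suc)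
  have "wact (Suc k) (Lam 0) = wact k (Lam 0) - (real k + 1) *\<^sub>R alpha (k mod 2)"
    using Suc by (simp add: sref_def)
  moreover have "Suc (Suc k) mod 2 = k mod 2" by simp
  ultimately show ?case using Suc a by (simp add: pair_diff pair_scaleR)
qed

lemma wact_Suc_Lam0:
  "wact (Suc k) (Lam 0) = wact k (Lam 0) - real (Suc k) *\<^sub>R alpha (k mod 2)"
  using pair_wact[of k] by (simp add: sref_def add.commute)

lemma wact_Lam0:
  "wact n (Lam 0) = Lam 0 - (\<Sum>k\<le>n. real k *\<^sub>R alpha (Suc k mod 2))"
proof (induction n)
  case (Suc n)
  have "Suc (Suc n) mod 2 = n mod 2" by simp
  then show ?case using Suc wact_Suc_Lam0[of n] by (simp del: wact.simps)
qed simp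

text \<open>Summation by parts. The left side weights each direction with the time spent in it; as
  consecutive directions differ by a multiple of one simple root, the right side collects one term
  per index k.\<close>

lemma abel_summation_wact:
  fixes b :: "nat \<Rightarrow> real"
  assumes "n \<le> m"
  shows "(\<Sum>k=n..m. (b k - b (Suc k)) *\<^sub>R wact k (Lam 0)) =
    b n *\<^sub>R wact n (Lam 0) - b (Suc m) *\<^sub>R wact m (Lam 0)
      - (\<Sum>k=Suc n..m. (real k * b k) *\<^sub>R alpha (Suc k mod 2))"
  using assms
proof (induction m rule: dec_induct)
  case base
  show ?case by (simp add: scaleR_left_diff_distrib)
next
  case (step m)
  have "Suc (Suc m) mod 2 = m mod 2" by simp
  then show ?case using step wact_Suc_Lam0[of m]
    by (simp del: wact.simps add: scaleR_left_diff_distrib scaleR_right_diff_distrib mult.commute)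
qed

text \<open>The lists enter only through their entries, so the same computation covers the data of
  \<open>Psi\<close> and an arbitrary LS datum.\<close>

lemma path_fun_eq_lpath:
  assumes l: "ladder l" and nm: "n \<le> m" and full: "\<And>q. q \<le> n \<Longrightarrow> l q = q" and zero: "\<And>q. m < q \<Longrightarrow> l q = 0"
    and len: "length ss = m + 1 - n"
    and ss: "\<And>j. j < m + 1 - n \<Longrightarrow> ss ! j = m - j"
    and as: "\<And>j. j \<le> m + 1 - n \<Longrightarrow> as ! j = brk l (m + 1 - j)"
  shows "path_fun ss as = lpath l"
proof
  fix t
  show "path_fun ss as t = lpath l t"
  proof (cases "0 \<le> t \<and> t \<le> 1")
    case False
    then show ?thesis using lpath_outside[OF False, of l] by (simp only: path_fun_def if_False)
  next
    case True
    \<comment> \<open>Truncating the break times at t turns the clipped interval lengths in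
      \<open>path_fun\<close> into differences of consecutive terms.\<close>
    define b where "b = (\<lambda>k. min t (brk l k))"
    have clip: "min (max t x) y - x = min t y - min t x" if "x \<le> y" for x y :: real
      using that by linarith
    have "path_fun ss as t =
      (\<Sum>j<m + 1 - n. (min (max t (as ! j)) (as ! (j + 1)) - as ! j) *\<^sub>R wact (ss ! j) (Lam 0))"
      using True by (simp add: path_fun_def len)
    also have "\<dots> = (\<Sum>j<m + 1 - n. (b (m - j) - b (Suc (m - j))) *\<^sub>R wact (m - j) (Lam 0))"
    proof (rule sum.cong[OF refl])
      fix j assume j: "j \<in> {..<m + 1 - n}"
      then have e: "as ! j = brk l (Suc (m - j))" "as ! (j + 1) = brk l (m - j)" "ss ! j = m - j"
        using as[of j] as[of "j + 1"] ss[of j] by (auto simp: Suc_diff_le)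
      show "(min (max t (as ! j)) (as ! (j + 1)) - as ! j) *\<^sub>R wact (ss ! j) (Lam 0) =
        (b (m - j) - b (Suc (m - j))) *\<^sub>R wact (m - j) (Lam 0)"
        unfolding e b_def using clip[OF brk_Suc_le[OF l, of "m - j"]] by simp
    qed
    also have "\<dots> = (\<Sum>k=n..m. (b k - b (Suc k)) *\<^sub>R wact k (Lam 0))"
      by (rule sum.reindex_bij_witness[of _ "\<lambda>k. m - k" "\<lambda>j. m - j"]) (use nm in auto)
    also have "\<dots> = b n *\<^sub>R wact n (Lam 0) - b (Suc m) *\<^sub>R wact m (Lam 0)
      - (\<Sum>k=Suc n..m. (real k * b k) *\<^sub>R alpha (Suc k mod 2))"
      by (rule abel_summation_wact[OF nm])
    \<comment> \<open>The boundary terms: index m + 1 is empty and has break time 0, index n is full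
      and has break time 1.\<close>
    also have "b (Suc m) = 0" using zero[of "Suc m"] True by (simp add: b_def brk_def)
    also have "b n = t" using full[of n] True by (simp add: b_def brk_def)
    also have "t *\<^sub>R wact n (Lam 0) = t *\<^sub>R Lam 0 - (\<Sum>k\<le>n. (real k * t) *\<^sub>R alpha (Suc k mod 2))"
      unfolding wact_Lam0 by (simp add: scaleR_right_diff_distrib scaleR_sum_right mult.commute)
    also have "(\<Sum>k\<le>n. (real k * t) *\<^sub>R alpha (Suc k mod 2)) = (\<Sum>k\<le>n. (real k * b k) *\<^sub>R alpha (Suc k mod 2))"
    proof (rule sum.cong[OF refl])
      fix k assume "k \<in> {..n}"
      then have "b k = t" using full[of k] True by (simp add: b_def brk_def)
      then show "(real k * t) *\<^sub>R alpha (Suc k mod 2) = (real k * b k) *\<^sub>R alpha (Suc k mod 2)" by simp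
    qed
    also have "t *\<^sub>R Lam 0 - (\<Sum>k\<le>n. (real k * b k) *\<^sub>R alpha (Suc k mod 2)) - 0 *\<^sub>R wact m (Lam 0)
      - (\<Sum>k=Suc n..m. (real k * b k) *\<^sub>R alpha (Suc k mod 2)) =
      t *\<^sub>R Lam 0 - (\<Sum>k\<le>m. (real k * b k) *\<^sub>R alpha (Suc k mod 2))"
    proof -
      have "{..m} = {..n} \<union> {Suc n..m}" using nm by auto
      moreover have "{..n} \<inter> {Suc n..m} = {}" by auto
      ultimately have "(\<Sum>k\<le>m. (real k * b k) *\<^sub>R alpha (Suc k mod 2)) =
        (\<Sum>k\<le>n. (real k * b k) *\<^sub>R alpha (Suc k mod 2)) + (\<Sum>k=Suc n..m. (real k * b k) *\<^sub>R alpha (Suc k mod 2))"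
        by (simp add: sum.union_disjoint)
      then show ?thesis by (simp only: scaleR_zero_left diff_zero diff_diff_eq)
    qed
    also have "(\<Sum>k\<le>m. (real k * b k) *\<^sub>R alpha (Suc k mod 2)) =
      (\<Sum>k\<le>m. min (real k * t) (real (l k)) *\<^sub>R alpha (Suc k mod 2))"
    proof (rule sum.cong[OF refl])
      fix k
      have "real k * b k = min (real k * t) (real k * brk l k)"
        by (simp add: b_def min_mult_distrib_left)
      then show "(real k * b k) *\<^sub>R alpha (Suc k mod 2) = min (real k * t) (real (l k)) *\<^sub>R alpha (Suc k mod 2)"
        by (simp add: brk_mult[OF l])
    qed
    also have "t *\<^sub>R Lam 0 - \<dots> = lpath l t"
      by (rule lpath_bounded[symmetric]) (use zero True in auto)
    finally show ?thesis .
  qed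
qed

section \<open>The data of \<open>Psi\<close> form an LS datum\<close>

definition ladder_times :: "(nat \<Rightarrow> nat) \<Rightarrow> nat \<Rightarrow> nat \<Rightarrow> real list" where
  "ladder_times l m n = 0 # map (\<lambda>q. real (l q) / real q) (rev [n + 1..<m + 1]) @ [1]"

lemma rev_upt_nth: "j < b - a \<Longrightarrow> rev [a..<b] ! j = b - 1 - j"
  by (simp add: rev_nth)

lemma ladder_times_length: "n \<le> m \<Longrightarrow> length (ladder_times l m n) = m + 2 - n"
  by (simp add: ladder_times_def Suc_diff_le del: upt_Suc)

text \<open>The initial 0 and the final 1 are break times too, of the empty index m + 1 and of the
  full index n. For n = 0 the latter rests on the value of \<open>brk\<close> at 0.\<close>

lemma ladder_times_nth:
  assumes "n \<le> m" "l n = n" "l (m + 1) = 0" "j \<le> m + 1 - n"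
  shows "ladder_times l m n ! j = brk l (m + 1 - j)"
proof -
  consider "j = 0" | i where "j = Suc i" "i < m - n" | "j = m + 1 - n"
    using assms(1,4) by (cases j) (auto simp: less_Suc_eq_le Suc_diff_le le_less)
  then show ?thesis
  proof cases
    case 1
    then show ?thesis using assms by (simp add: ladder_times_def brk_def)
  next
    case (2 i)
    then have "rev [n + 1..<m + 1] ! i = m - i" using rev_upt_nth[of i "m + 1" "n + 1"] by simp
    moreover have "i < m" using 2 by linarith
    ultimately show ?thesis using 2 by (simp add: ladder_times_def nth_append brk_def del: upt_Suc)
  next
    case 3
    then have "ladder_times l m n ! j = 1"
      using assms(1) by (simp add: ladder_times_def nth_append Suc_diff_le del: upt_Suc)
    then show ?thesis using 3 assms by (simp add: brk_def)
  qed
qed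

lemma length_le_first_part:
  assumes "regular xs"
  shows "length xs \<le> part xs 1"
proof (cases "xs = []")
  case False
  then have "0 < part xs (length xs)"
    using part_pos_iff[OF assms, of "length xs - 1"] by simp
  then show ?thesis using part_diag_antimono[OF assms, of 1 "length xs"] False by (simp add: Suc_leI)
qed simp

text \<open>Truncated subtraction does no harm: q - length xs is positive, so a row passes the test
  only if the difference on the right is a genuine one.\<close>

lemma lad_eq_Psi_index:
  assumes "regular xs" "length xs < q"
  shows "card {k \<in> {1..length xs}. q - length xs \<le> xs ! (k - 1) - (length xs - k + 1)} = lad xs q"
proof -
  have "{k \<in> {1..length xs}. q - length xs \<le> xs ! (k - 1) - (length xs - k + 1)} = {k \<in> {1..q}. q < part xs k + k}"
  proof (intro set_eqI)
    fix k
    show "k \<in> {k \<in> {1..length xs}. q - length xs \<le> xs ! (k - 1) - (length xs - k + 1)} \<longleftrightarrow>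
      k \<in> {k \<in> {1..q}. q < part xs k + k}"
    proof (cases "1 \<le> k \<and> k \<le> length xs")
      case True
      then have "part xs k = xs ! (k - 1)" by (simp add: part_def)
      then show ?thesis using True assms(2) by auto
    next
      case False
      then show ?thesis using part_beyond[of xs k] by (cases "k = 0") auto
    qed
  qed
  then show ?thesis by (simp add: lad_def)
qed

lemma Psi_eq_path_fun:
  assumes "regular xs"
  shows "Psi (xs, 0) = path_fun (rev [length xs..<part xs 1 + 1]) (ladder_times (lad xs) (part xs 1) (length xs))"
proof -
  have m: "(if xs = [] then 0 else hd xs) = part xs 1"
    by (cases xs) (auto simp: part_def)
  have "map (\<lambda>q. real (card {k \<in> {1..length xs}. q - length xs \<le> xs ! (k - 1) - (length xs - k + 1)}) / real q)
      (rev [length xs + 1..<part xs 1 + 1]) =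
    map (\<lambda>q. real (lad xs q) / real q) (rev [length xs + 1..<part xs 1 + 1])"
    using lad_eq_Psi_index[OF assms] by (intro map_cong) auto
  then show ?thesis unfolding Psi_def Let_def fst_conv m ladder_times_def by (rule arg_cong)
qed

lemma Psi_eq_lpath:
  assumes "regular xs"
  shows "Psi (xs, 0) = lpath (lad xs)"
  unfolding Psi_eq_path_fun[OF assms]
proof (rule path_fun_eq_lpath[OF ladder_lad[OF assms] length_le_first_part[OF assms]])
  show "lad xs q = q" if "q \<le> length xs" for q using lad_full[OF assms that] .
  show zero: "lad xs q = 0" if "part xs 1 < q" for q using lad_0_iff[OF assms, of q] that by simp
  show "length (rev [length xs..<part xs 1 + 1]) = part xs 1 + 1 - length xs"
    by (simp del: upt_Suc)
  show "rev [length xs..<part xs 1 + 1] ! j = part xs 1 - j" if "j < part xs 1 + 1 - length xs" for j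
    using rev_upt_nth[OF that] by simp
  show "ladder_times (lad xs) (part xs 1) (length xs) ! j = brk (lad xs) (part xs 1 + 1 - j)"
    if "j \<le> part xs 1 + 1 - length xs" for j
    using ladder_times_nth[of "length xs" "part xs 1" "lad xs" j] length_le_first_part[OF assms]
      lad_full[OF assms order_refl] zero[of "part xs 1 + 1"] that by simp
qed

lemma brk_strict_decreasing:
  assumes "ladder l" "l k < k" "0 < l k"
  shows "brk l (Suc k) < brk l k"
proof -
  have "real (l (Suc k)) / real (Suc k) \<le> real (l k) / real (Suc k)"
    using ladder_step[OF assms(1,2)] by (simp add: divide_right_mono)
  also have "\<dots> < real (l k) / real k" using assms by (intro divide_strict_left_mono) auto
  finally show ?thesis using assms(2) by (simp add: brk_def)
qed

lemma Psi_in_P_Lam0: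
  assumes r: "regular xs"
  shows "Psi (xs, 0) \<in> P_Lam0"
proof -
  define n where "n = length xs"
  define m where "m = part xs 1"
  define l where "l = lad xs"
  have nm: "n \<le> m" using length_le_first_part[OF r] by (simp add: n_def m_def)
  have l: "ladder l" using ladder_lad[OF r] by (simp add: l_def)
  have full: "l n = n" using lad_full[OF r] by (simp add: l_def n_def)
  have zero: "l (m + 1) = 0" using lad_0_iff[OF r, of "m + 1"] by (simp add: l_def m_def)
  have lt: "l q < q" if "n < q" for q using lad_not_full[OF r] that by (simp add: l_def n_def)
  have pos: "0 < l q" if "0 < q" "q \<le> m" for q using lad_0_iff[OF r, of q] that by (auto simp: l_def m_def)
  let ?ss = "rev [n..<m + 1]" and ?as = "ladder_times l m n"
  have len: "length ?as = m + 2 - n" using ladder_times_length[OF nm] .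
  have nth: "?as ! j = brk l (m + 1 - j)" if "j \<le> m + 1 - n" for j
    using ladder_times_nth[of n m l] nm full zero that by blast
  have ssn: "?ss ! j = m - j" if "j < m + 1 - n" for j using rev_upt_nth[OF that] by simp
  have "LS_datum ?ss ?as"
    unfolding LS_datum_def
  proof (intro conjI)
    show "?ss \<noteq> []" using nm by simp
    show "length ?as = length ?ss + 1" using len nm by simp
    show "?as ! 0 = 0" by (simp add: ladder_times_def)
    show "last ?as = 1" by (simp add: ladder_times_def)
    show "sorted_wrt (<) ?as"
    proof (subst sorted_wrt_iff_nth_Suc_transp)
      show "transp ((<) :: real \<Rightarrow> real \<Rightarrow> bool)" by (simp add: transp_def)
      show "\<forall>j. Suc j < length ?as \<longrightarrow> ?as ! j < ?as ! Suc j"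
      proof (intro allI impI)
        fix j assume "Suc j < length ?as"
        then have j: "j \<le> m + 1 - n" "Suc j \<le> m + 1 - n" "j \<le> m" using len nm by auto
        define k where "k = m - j"
        have e: "?as ! j = brk l (Suc k)" "?as ! Suc j = brk l k"
          using nth[OF j(1)] nth[OF j(2)] j by (simp_all add: k_def Suc_diff_le)
        have k: "n \<le> k" "k \<le> m" using j nm by (auto simp: k_def)
        show "?as ! j < ?as ! Suc j"
        \<comment> \<open>Index n has break time 1, and n + 1 is the first index that is not full.
          Beyond n, strictness comes from positive counts that do not increase, divided by growing
          denominators.\<close>
        proof (cases "k = n")
          case True
          then have "brk l k = 1" using full by (simp add: brk_def)
          moreover have "brk l (Suc k) < 1" using lt[of "Suc k"] k by (simp add: brk_def)
          ultimately show ?thesis unfolding e by simp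
        next
          case False
          then show ?thesis unfolding e using brk_strict_decreasing[OF l lt pos, of k] k by simp
        qed
      qed
    qed
    show "\<forall>a\<in>set ?as. a \<in> \<rat>" by (auto simp: ladder_times_def)
    show "sorted_wrt (>) ?ss" by (simp add: sorted_wrt_rev del: upt_Suc)
    \<comment> \<open>Every link is a single reflection, and its condition is integrality of k + 1
      times the break time of k + 1, which is l (k + 1).\<close>
    show "\<forall>j. 1 \<le> j \<and> j < length ?ss \<longrightarrow> achain (?as ! j) (?ss ! (j - 1)) (?ss ! j)"
    proof (intro allI impI)
      fix j assume "1 \<le> j \<and> j < length ?ss"
      then have j: "1 \<le> j" "j < m + 1 - n" "j \<le> m" using nm by auto
      define k where "k = m - j"
      have e: "?ss ! j = k" "?ss ! (j - 1) = Suc k" "?as ! j = brk l (Suc k)"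
        using ssn[of j] ssn[of "j - 1"] nth[of j] j by (simp_all add: k_def Suc_diff_le)
      have "real (Suc k) * brk l (Suc k) = real (l (Suc k))" using brk_mult[OF l] by blast
      then have "brk l (Suc k) * pair (wact k (Lam 0)) (k mod 2) = real (l (Suc k))"
        using pair_wact[of k] by (simp add: algebra_simps)
      then have "brk l (Suc k) * pair (wact k (Lam 0)) (k mod 2) \<in> \<int>" by simp
      note int = this
      have "achain (brk l (Suc k)) (Suc k) k"
        unfolding achain_def
      proof (intro conjI allI impI)
        fix i assume "k < i \<and> i \<le> Suc k"
        then have "i = Suc k" by simp
        then show "brk l (Suc k) * pair (wact (i - 1) (Lam 0)) ((i - 1) mod 2) \<in> \<int>" using int by simp
      qed simp
      then show "achain (?as ! j) (?ss ! (j - 1)) (?ss ! j)" by (simp only: e)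
    qed
  qed
  then show ?thesis unfolding P_Lam0_def Psi_eq_path_fun[OF r] n_def m_def l_def by blast
qed

section \<open>From LS data back to ladder sequences\<close>

lemma achain_mult_Ints:
  assumes "achain a m n" "n < k" "k \<le> m"
  shows "a * real k \<in> \<int>"
proof -
  obtain j where j: "k = Suc j" using assms(2) by (cases k) auto
  have "a * pair (wact (k - 1) (Lam 0)) ((k - 1) mod 2) \<in> \<int>" using assms by (simp add: achain_def)
  then show ?thesis using pair_wact[of j] j by (simp add: add.commute)
qed

text \<open>If an index were skipped, a times m and a times m - 1 would both be integers, hence also
  their difference a, which lies strictly between 0 and 1.\<close>

lemma achain_consecutive:
  assumes "achain a m n" "0 < a" "a < 1"
  shows "m = Suc n"
proof (rule ccontr)
  assume "m \<noteq> Suc n"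
  then have m: "n < m - 1" "m - 1 \<le> m" "n < m" using assms(1) by (auto simp: achain_def)
  have "a * real m - a * real (m - 1) \<in> \<int>"
    using achain_mult_Ints[OF assms(1), of m] achain_mult_Ints[OF assms(1) m(1,2)] m by auto
  moreover have "a * real m - a * real (m - 1) = a" using m by (simp add: of_nat_diff algebra_simps)
  ultimately have "a \<in> \<int>" by simp
  then show False using assms(2,3) by (auto elim!: Ints_cases)
qed

lemma LS_datum_imp_lpath:
  assumes LS: "LS_datum ss as"
  shows "\<exists>l. ladder l \<and> path_fun ss as = lpath l"
proof -
  define r where "r = length ss"
  define m where "m = ss ! 0"
  have r0: "0 < r" using LS by (simp add: LS_datum_def r_def)
  have len: "length as = r + 1" using LS by (simp add: LS_datum_def r_def)
  have a0: "as ! 0 = 0" using LS by (simp add: LS_datum_def)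
  have ar: "as ! r = 1"
  proof -
    have "last as = 1" "as \<noteq> []" using LS len by (auto simp: LS_datum_def)
    then show ?thesis using len by (simp add: last_conv_nth)
  qed
  have mono: "as ! i < as ! j" if "i < j" "j \<le> r" for i j
    using LS that len by (simp add: LS_datum_def sorted_wrt_iff_nth_less)
  have bounds: "0 < as ! j" "as ! j < 1" if "1 \<le> j" "j < r" for j
    using mono[of 0 j] mono[of j r] that a0 ar by auto
  have chain: "achain (as ! j) (ss ! (j - 1)) (ss ! j)" if "1 \<le> j" "j < r" for j
    using LS that by (simp add: LS_datum_def r_def)
  have ss: "ss ! j + j = m" if "j < r" for j
    using that
  proof (induction j)
    case (Suc j)
    then have "ss ! j = Suc (ss ! Suc j)"
      using achain_consecutive[OF chain bounds, of "Suc j"] by simp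
    then show ?case using Suc by simp
  qed (simp add: m_def)
  define n where "n = m + 1 - r"
  have rm: "r \<le> m + 1" using ss[of "r - 1"] r0 by simp
  then have nm: "n \<le> m" "r = m + 1 - n" using r0 by (auto simp: n_def)
  \<comment> \<open>The count is q times the break time of q, an integer by the chain condition, so
    the floor is exact. Indices up to the last direction n are full.\<close>
  define l where "l q = (if q \<le> n then q else if q \<le> m then nat \<lfloor>as ! (m + 1 - q) * real q\<rfloor> else 0)" for q
  have mid: "real (l q) = as ! (m + 1 - q) * real q" if q: "n < q" "q \<le> m" for q
  proof -
    define j where "j = m + 1 - q"
    have j: "1 \<le> j" "j < r" using q nm by (auto simp: j_def)
    have "j + q = m + 1" using q by (simp add: j_def)
    moreover have "ss ! (j - 1) + (j - 1) = m" "ss ! j + j = m" using ss[of "j - 1"] ss[of j] j by simp_all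
    ultimately have "ss ! (j - 1) = q" "ss ! j < q" using j by linarith+
    then have "as ! j * real q \<in> \<int>" using achain_mult_Ints[OF chain[OF j], of q] by simp
    moreover have "0 \<le> as ! j * real q" using bounds[OF j] by simp
    ultimately have "real (nat \<lfloor>as ! j * real q\<rfloor>) = as ! j * real q" by (auto elim!: Ints_cases)
    then show ?thesis using q by (simp add: l_def j_def)
  qed
  have full: "l q = q" if "q \<le> n" for q using that by (simp add: l_def)
  have zero: "l q = 0" if "m < q" for q using that nm by (simp add: l_def)
  have a_mid: "0 < as ! (m + 1 - q)" "as ! (m + 1 - q) < 1" if "n < q" "q \<le> m" for q
    using bounds[of "m + 1 - q"] that nm by auto
  have le: "l q \<le> q" for q
  proof (cases "n < q \<and> q \<le> m")
    case True
    then have "real (l q) \<le> 1 * real q" using mid[of q] a_mid[of q] by (simp add: mult_right_mono)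
    then show ?thesis by simp
  next
    case False then show ?thesis using full[of q] zero[of q] by fastforce
  qed
  have step: "l q = q \<or> l (Suc q) \<le> l q" for q
  proof -
    consider "q \<le> n" | "n < q" "q < m" | "m \<le> q" by linarith
    then show ?thesis
    proof cases
      case 2
      define j where "j = m - q"
      have j: "m + 1 - q = Suc j" "m + 1 - Suc q = j" "Suc j \<le> r" using 2 nm by (auto simp: j_def)
      \<comment> \<open>The times increase strictly and stay below 1, which bounds l (q + 1)
        strictly by l q + 1; integrality then gives the ladder inequality.\<close>
      have "real (l (Suc q)) = as ! j * real (Suc q)" using mid[of "Suc q"] 2 j by simp
      also have "\<dots> < as ! Suc j * real (Suc q)" using mono[of j "Suc j"] j by simp
      also have "\<dots> = real (l q) + as ! Suc j" using mid[of q] 2 j by (simp add: algebra_simps)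
      also have "\<dots> < real (l q) + 1" using a_mid[of q] 2 j by simp
      finally show ?thesis by linarith
    qed (use full zero in auto)
  qed
  have "finite {q. l q \<noteq> 0}" by (rule finite_subset[of _ "{..m}"]) (use zero in \<open>auto simp: not_less[symmetric]\<close>)
  then have lad: "ladder l" using le step by (simp add: ladder_def)
  have "path_fun ss as = lpath l"
  proof (rule path_fun_eq_lpath[OF lad nm(1)])
    show "length ss = m + 1 - n" using nm by (simp add: r_def)
    show "ss ! j = m - j" if "j < m + 1 - n" for j using ss[of j] that nm by simp
    show "as ! j = brk l (m + 1 - j)" if "j \<le> m + 1 - n" for j
    proof -
      define q where "q = m + 1 - j"
      have q: "n \<le> q" "q \<le> m + 1" "j = m + 1 - q" using that nm by (auto simp: q_def)
      consider "q = n" | "n < q" "q \<le> m" | "q = m + 1" using q by linarith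
      then have "as ! j = brk l q"
      proof cases
        case 1
        then have "brk l q = 1" using full by (simp add: brk_def)
        then show ?thesis using q 1 ar nm by simp
      next
        case 2 then show ?thesis using mid[of q] q by (simp add: brk_def)
      next
        case 3 then show ?thesis using zero[of q] a0 q by (simp add: brk_def)
      qed
      then show ?thesis by (simp add: q_def)
    qed
  qed (use full zero in auto)
  then show ?thesis using lad by blast
qed

section \<open>Injectivity and weights\<close>

definition colour_sum :: "nat \<Rightarrow> (nat \<Rightarrow> nat) \<Rightarrow> nat \<Rightarrow> real \<Rightarrow> real" where
  "colour_sum i l B t = (\<Sum>k | k \<le> B \<and> Suc k mod 2 = i. min (real k * t) (real (l k)))"

lemma lpath_colour_sum:
  assumes "\<And>q. B < q \<Longrightarrow> l q = 0" "0 \<le> t" "t \<le> 1"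
  shows "lpath l t = t *\<^sub>R Lam 0 - colour_sum 0 l B t *\<^sub>R alpha 0 - colour_sum 1 l B t *\<^sub>R alpha 1"
proof -
  have split: "{..B} = {k. k \<le> B \<and> Suc k mod 2 = 0} \<union> {k. k \<le> B \<and> Suc k mod 2 = 1}"
    by (auto simp: mod_Suc)
  have disj: "{k. k \<le> B \<and> Suc k mod 2 = 0} \<inter> {k. k \<le> B \<and> Suc k mod 2 = 1} = {}" by auto
  have "(\<Sum>k\<le>B. min (real k * t) (real (l k)) *\<^sub>R alpha (Suc k mod 2)) =
    colour_sum 0 l B t *\<^sub>R alpha 0 + colour_sum 1 l B t *\<^sub>R alpha 1"
    unfolding split by (subst sum.union_disjoint[OF _ _ disj]) (auto simp: colour_sum_def scaleR_sum_left)
  then show ?thesis using lpath_bounded[OF assms] by (simp only: diff_diff_eq)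
qed

text \<open>At the break time of k for l', the summands of l' up to index k are not cut off by their
  caps, hence at least those of l, and beyond k the two agree. The strict inequality at k therefore
  shows in the coefficient of the simple root of its colour.\<close>

lemma lpath_inj_aux:
  assumes "ladder l" "ladder l'" and eq: "lpath l = lpath l'" and less: "l k < l' k" and above: "\<And>j. k < j \<Longrightarrow> l j = l' j"
  shows False
proof -
  obtain B1 where B1: "\<And>q. B1 < q \<Longrightarrow> l q = 0" using ladder_finite_support[OF assms(1)] by blast
  obtain B2 where B2: "\<And>q. B2 < q \<Longrightarrow> l' q = 0" using ladder_finite_support[OF assms(2)] by blast
  define B where "B = max k (max B1 B2)"
  define t where "t = brk l' k"
  define i where "i = Suc k mod 2"
  have t: "0 \<le> t" "t \<le> 1" using brk_nonneg brk_le_1[OF assms(2)] by (auto simp: t_def)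
  have B: "\<And>q. B < q \<Longrightarrow> l q = 0" "\<And>q. B < q \<Longrightarrow> l' q = 0" using B1 B2 by (auto simp: B_def)
  have e1: "lpath l t = t *\<^sub>R Lam 0 - colour_sum 0 l B t *\<^sub>R alpha 0 - colour_sum 1 l B t *\<^sub>R alpha 1"
    by (rule lpath_colour_sum) (use B t in auto)
  have e2: "lpath l' t = t *\<^sub>R Lam 0 - colour_sum 0 l' B t *\<^sub>R alpha 0 - colour_sum 1 l' B t *\<^sub>R alpha 1"
    by (rule lpath_colour_sum) (use B t in auto)
  have "colour_sum 0 l B t = colour_sum 0 l' B t \<and> colour_sum 1 l B t = colour_sum 1 l' B t"
    using e1 e2 eq by (simp add: Lam_def alpha_def)
  then have "colour_sum i l B t = colour_sum i l' B t" by (auto simp: i_def mod_Suc)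
  moreover have "colour_sum i l B t < colour_sum i l' B t"
    unfolding colour_sum_def
  proof (rule sum_strict_mono_ex1)
    show "finite {k. k \<le> B \<and> Suc k mod 2 = i}" by simp
    have full: "real j * t \<le> real (l' j)" if "j \<le> k" for j
    proof -
      have "real j * t \<le> real j * brk l' j"
        using brk_antimono[OF assms(2) that] by (simp add: t_def mult_left_mono)
      then show ?thesis by (simp add: brk_mult[OF assms(2)])
    qed
    show "\<forall>j\<in>{k. k \<le> B \<and> Suc k mod 2 = i}. min (real j * t) (real (l j)) \<le> min (real j * t) (real (l' j))"
    proof
      fix j
      show "min (real j * t) (real (l j)) \<le> min (real j * t) (real (l' j))"
        using full[of j] above[of j] by (cases "j \<le> k") auto
    qed
    have "real k * t = real (l' k)" using brk_mult[OF assms(2)] by (simp add: t_def)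
    then have "min (real k * t) (real (l k)) < min (real k * t) (real (l' k))" using less by simp
    then show "\<exists>j\<in>{k. k \<le> B \<and> Suc k mod 2 = i}. min (real j * t) (real (l j)) < min (real j * t) (real (l' j))"
      by (intro bexI[of _ k]) (auto simp: B_def i_def)
  qed
  ultimately show False by simp
qed

lemma lpath_inj:
  assumes "ladder l" "ladder l'" and eq: "lpath l = lpath l'"
  shows "l = l'"
proof (rule ccontr)
  assume ne: "l \<noteq> l'"
  let ?S = "{q. l q \<noteq> l' q}"
  have "finite ({q. l q \<noteq> 0} \<union> {q. l' q \<noteq> 0})" using assms by (auto simp: ladder_def)
  then have fin: "finite ?S" by (rule rev_finite_subset) auto
  have nonempty: "?S \<noteq> {}" using ne by auto
  define k where "k = Max ?S"
  have k: "l k \<noteq> l' k" using Max_in[OF fin nonempty] by (simp add: k_def)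
  have above: "l j = l' j" if "k < j" for j using Max_ge[OF fin, of j] that by (auto simp: k_def)
  show False
  proof (cases "l k < l' k")
    case True
    then show ?thesis using lpath_inj_aux[OF assms] above by blast
  next
    case False
    then show ?thesis using lpath_inj_aux[OF assms(2,1) eq[symmetric], of k] above k by simp
  qed
qed

lemma bij_betw_Psi: "bij_betw Psi (Y 0) P_Lam0"
  unfolding bij_betw_def
proof
  show "inj_on Psi (Y 0)"
  proof (rule inj_onI)
    fix b b' assume "b \<in> Y 0" "b' \<in> Y 0" and eq: "Psi b = Psi b'"
    then obtain xs ys where xs: "b = (xs, 0)" "regular xs" and ys: "b' = (ys, 0)" "regular ys"
      by (auto simp: Y_def)
    have "lpath (lad xs) = lpath (lad ys)" using eq xs ys by (simp add: Psi_eq_lpath)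
    then have "lad xs = lad ys" using lpath_inj[OF ladder_lad ladder_lad] xs ys by blast
    then show "b = b'" using lad_inj xs ys by blast
  qed
  show "Psi ` Y 0 = P_Lam0"
  proof (intro equalityI subsetI)
    fix p assume "p \<in> Psi ` Y 0"
    then show "p \<in> P_Lam0" using Psi_in_P_Lam0 by (auto simp: Y_def)
  next
    fix p assume "p \<in> P_Lam0"
    then obtain l where l: "ladder l" "p = lpath l" using LS_datum_imp_lpath by (auto simp: P_Lam0_def)
    then obtain xs where "regular xs" "lad xs = l" using ladder_imp_lad by blast
    then have "p = Psi (xs, 0)" "(xs, 0) \<in> Y 0" using l by (auto simp: Psi_eq_lpath Y_def)
    then show "p \<in> Psi ` Y 0" by blast
  qed
qed

text \<open>Modulo 2 the numbers -r and r agree, which is why labels are constant on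
  antidiagonals.\<close>

lemma label_0: "label 0 r c = (r + c) mod 2"
proof -
  have "(int c - int r) mod 2 = (int r + int c) mod 2" by presburger
  then show ?thesis by (simp add: label_def nat_mod_as_int)
qed

lemma nboxes_eq_colour_sum:
  assumes r: "regular xs"
  shows "real (nboxes (xs, 0) i) = colour_sum i (lad xs) (part xs 1) 1"
proof -
  let ?Q = "{k. k \<le> part xs 1 \<and> Suc k mod 2 = i}"
  let ?D = "\<lambda>q. {k \<in> {1..q}. q < part xs k + k}"
  let ?X = "{(r, c). 1 \<le> r \<and> r \<le> length xs \<and> 1 \<le> c \<and> c \<le> part xs r \<and> label 0 r c = i}"
  \<comment> \<open>Boxes are indexed by antidiagonal and row. No box lies beyond antidiagonal
    \<open>part xs 1\<close>, which explains the bound in \<open>colour_sum\<close>.\<close>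
  have "bij_betw (\<lambda>(q, k). (k, q + 1 - k)) (Sigma ?Q ?D) ?X"
  proof (rule bij_betw_byWitness[where f' = "\<lambda>(r, c). (r + c - 1, r)"])
    show "\<forall>a\<in>Sigma ?Q ?D. (case case a of (q, k) \<Rightarrow> (k, q + 1 - k) of (r, c) \<Rightarrow> (r + c - 1, r)) = a" by auto
    show "\<forall>a\<in>?X. (case case a of (r, c) \<Rightarrow> (r + c - 1, r) of (q, k) \<Rightarrow> (k, q + 1 - k)) = a" by auto
    show "(\<lambda>(q, k). (k, q + 1 - k)) ` Sigma ?Q ?D \<subseteq> ?X"
    proof
      fix p assume "p \<in> (\<lambda>(q, k). (k, q + 1 - k)) ` Sigma ?Q ?D"
      then obtain q k where p: "p = (k, q + 1 - k)" and a: "Suc q mod 2 = i" "1 \<le> k" "k \<le> q" "q < part xs k + k"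
        by auto
      have "k \<le> length xs" using a part_beyond[of xs k] by (cases "k \<le> length xs") auto
      then show "p \<in> ?X" using a by (auto simp: p label_0)
    qed
    show "(\<lambda>(r, c). (r + c - 1, r)) ` ?X \<subseteq> Sigma ?Q ?D"
    proof
      fix p assume "p \<in> (\<lambda>(r, c). (r + c - 1, r)) ` ?X"
      then obtain k c where p: "p = (k + c - 1, k)"
        and a: "1 \<le> k" "k \<le> length xs" "1 \<le> c" "c \<le> part xs k" "label 0 k c = i" by auto
      have "part xs k + k \<le> part xs 1 + 1" using part_diag_antimono[OF r, of 1 k] a by simp
      then show "p \<in> Sigma ?Q ?D" using a by (auto simp: p label_0)
    qed
  qed
  from bij_betw_same_card[OF this] have "card ?X = card (Sigma ?Q ?D)" by (rule sym)
  also have "\<dots> = (\<Sum>q\<in>?Q. lad xs q)" by (simp add: lad_def)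
  finally have "nboxes (xs, 0) i = (\<Sum>q\<in>?Q. lad xs q)" by (simp add: nboxes_def)
  then show ?thesis by (simp add: colour_sum_def min_absorb2 lad_le)
qed

lemma Psi_weight:
  assumes "regular xs"
  shows "pweight (Psi (xs, 0)) = cweight (xs, 0)"
proof -
  have "lpath (lad xs) 1 = 1 *\<^sub>R Lam 0 - colour_sum 0 (lad xs) (part xs 1) 1 *\<^sub>R alpha 0
      - colour_sum 1 (lad xs) (part xs 1) 1 *\<^sub>R alpha 1"
    by (rule lpath_colour_sum) (use lad_0_iff[OF assms] in auto)
  then show ?thesis
    by (simp add: pweight_def cweight_def Psi_eq_lpath[OF assms] nboxes_eq_colour_sum[OF assms])
qed

section \<open>Signatures\<close>

definition hgt :: "bool list \<Rightarrow> int" where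
  "hgt s = int (nplus s) - int (nminus s)"

lemma hgt_Nil [simp]: "hgt [] = 0"
  by (simp add: hgt_def nplus_def nminus_def)

lemma hgt_append [simp]: "hgt (s @ u) = hgt s + hgt u"
  by (simp add: hgt_def nplus_def nminus_def)

lemma hgt_Cons [simp]: "hgt (x # s) = (if x then 1 else -1) + hgt s"
  by (simp add: hgt_def nplus_def nminus_def)

lemma hgt_take_Suc: "p < length s \<Longrightarrow> hgt (take (Suc p) s) = hgt (take p s) + (if s ! p then 1 else -1)"
  by (simp add: take_Suc_conv_app_nth)

lemma hgt_take_drop: "hgt (take k (drop a s)) = hgt (take (a + k) s) - hgt (take a s)"
  by (simp add: take_add)

text \<open>With signs read as steps 1 and -1 of a walk, a reducible substring is an excursion that
  never rises above its starting height and ends there.\<close>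

lemma in_reducible_iff:
  "in_reducible s p \<longleftrightarrow> (\<exists>a b. a \<le> p \<and> p < b \<and> b \<le> length s \<and> hgt (take b s) = hgt (take a s) \<and>
     (\<forall>x. a \<le> x \<and> x \<le> b \<longrightarrow> hgt (take x s) \<le> hgt (take a s)))"
proof -
  have "reducible (take (b - a) (drop a s)) \<longleftrightarrow> hgt (take b s) = hgt (take a s) \<and>
     (\<forall>x. a \<le> x \<and> x \<le> b \<longrightarrow> hgt (take x s) \<le> hgt (take a s))"
    if ab: "a \<le> b" "b \<le> length s" for a b
  proof -
    let ?u = "take (b - a) (drop a s)"
    have red: "reducible ?u \<longleftrightarrow> hgt ?u = 0 \<and> (\<forall>k\<le>b - a. hgt (take k ?u) \<le> 0)"
      using ab by (auto simp: reducible_def hgt_def)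
    have "hgt ?u = hgt (take b s) - hgt (take a s)" using ab by (simp add: hgt_take_drop)
    moreover have "(\<forall>k\<le>b - a. hgt (take k ?u) \<le> 0) \<longleftrightarrow>
      (\<forall>x. a \<le> x \<and> x \<le> b \<longrightarrow> hgt (take x s) \<le> hgt (take a s))"
    proof (intro iffI allI impI)
      fix x assume *: "\<forall>k\<le>b - a. hgt (take k ?u) \<le> 0" and x: "a \<le> x \<and> x \<le> b"
      then have "hgt (take (x - a) ?u) \<le> 0" by simp
      moreover have "take (x - a) ?u = take (x - a) (drop a s)" using x by (simp add: min_def diff_le_mono)
      ultimately have "hgt (take (x - a) (drop a s)) \<le> 0" by metis
      then show "hgt (take x s) \<le> hgt (take a s)" unfolding hgt_take_drop using x by simp
    next
      fix k assume *: "\<forall>x. a \<le> x \<and> x \<le> b \<longrightarrow> hgt (take x s) \<le> hgt (take a s)" and k: "k \<le> b - a"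
      then have "hgt (take (a + k) s) \<le> hgt (take a s)" using ab by simp
      moreover have "take k ?u = take k (drop a s)" using k by (simp add: min_def)
      ultimately show "hgt (take k ?u) \<le> 0" by (simp only: hgt_take_drop)
    qed
    ultimately show ?thesis using red by simp
  qed
  note key = this
  have "(a \<le> p \<and> p < b \<and> b \<le> length s \<and> reducible (take (b - a) (drop a s))) \<longleftrightarrow>
    (a \<le> p \<and> p < b \<and> b \<le> length s \<and> hgt (take b s) = hgt (take a s) \<and>
     (\<forall>x. a \<le> x \<and> x \<le> b \<longrightarrow> hgt (take x s) \<le> hgt (take a s)))" for a b
    using key[of a b] by (cases "a \<le> p \<and> p < b \<and> b \<le> length s") auto
  then show ?thesis by (simp only: in_reducible_def)
qed

text \<open>A plus that sets no new record closes an excursion. It starts at the last earlier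
  position whose height is at least the one after the plus; as heights change by one per step, the
  two heights agree.\<close>

lemma plus_survives_iff:
  assumes p: "p < length s" "s ! p"
  shows "\<not> in_reducible s p \<longleftrightarrow> (\<forall>a\<le>p. hgt (take a s) < hgt (take (Suc p) s))"
proof
  assume *: "\<forall>a\<le>p. hgt (take a s) < hgt (take (Suc p) s)"
  show "\<not> in_reducible s p"
  proof
    assume "in_reducible s p"
    then obtain a b where "a \<le> p" "p < b" "\<forall>x. a \<le> x \<and> x \<le> b \<longrightarrow> hgt (take x s) \<le> hgt (take a s)"
      by (auto simp: in_reducible_iff)
    then have "hgt (take (Suc p) s) \<le> hgt (take a s)" by (simp add: Suc_leI)
    then show False using * \<open>a \<le> p\<close> by (simp add: not_less[symmetric])
  qed
next
  assume nr: "\<not> in_reducible s p"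
  show "\<forall>a\<le>p. hgt (take a s) < hgt (take (Suc p) s)"
  proof (rule ccontr)
    assume "\<not> ?thesis"
    then obtain a0 where a0: "a0 \<le> p \<and> hgt (take (Suc p) s) \<le> hgt (take a0 s)" by (auto simp: not_less)
    let ?P = "\<lambda>a. a \<le> p \<and> hgt (take (Suc p) s) \<le> hgt (take a s)"
    define a where "a = (GREATEST a. ?P a)"
    have a: "?P a" unfolding a_def by (rule GreatestI_nat[of ?P, OF a0, of p]) simp
    have gr: "x \<le> a" if "?P x" for x unfolding a_def by (rule Greatest_le_nat[of ?P, OF that, of p]) simp
    have hp: "hgt (take (Suc p) s) = hgt (take p s) + 1" using hgt_take_Suc[OF p(1)] p(2) by simp
    have "a \<noteq> p" using a hp by auto
    then have ap: "a < p" using a by simp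
    have "\<not> ?P (Suc a)" using gr[of "Suc a"] by auto
    then have "hgt (take (Suc a) s) < hgt (take (Suc p) s)" using ap by simp
    moreover have "hgt (take a s) \<le> hgt (take (Suc a) s) + 1" using hgt_take_Suc[of a s] ap p by simp
    ultimately have eq: "hgt (take (Suc p) s) = hgt (take a s)" using a by simp
    have "hgt (take x s) \<le> hgt (take a s)" if "a \<le> x" "x \<le> Suc p" for x
    proof (cases "x = a \<or> x = Suc p")
      case False
      then have "\<not> ?P x" using gr[of x] that by auto
      then show ?thesis using eq that False by simp
    qed (use eq in auto)
    then have "in_reducible s p" unfolding in_reducible_iff
      using ap eq p by (intro exI[of _ a] exI[of _ "Suc p"]) simp
    then show False using nr by simp
  qed
qed

text \<open>Dually, a minus is cancelled when the walk climbs back to the height before it, and the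
  first such return closes the excursion.\<close>

lemma minus_survives_iff:
  assumes p: "p < length s" "\<not> s ! p"
  shows "\<not> in_reducible s p \<longleftrightarrow> (\<forall>b. p < b \<and> b \<le> length s \<longrightarrow> hgt (take b s) < hgt (take p s))"
proof
  assume *: "\<forall>b. p < b \<and> b \<le> length s \<longrightarrow> hgt (take b s) < hgt (take p s)"
  show "\<not> in_reducible s p"
  proof
    assume "in_reducible s p"
    then obtain a b where ab: "a \<le> p" "p < b" "b \<le> length s" "hgt (take b s) = hgt (take a s)"
      "\<forall>x. a \<le> x \<and> x \<le> b \<longrightarrow> hgt (take x s) \<le> hgt (take a s)"
      by (auto simp: in_reducible_iff)
    then have "hgt (take p s) \<le> hgt (take a s)" by simp
    moreover have "hgt (take b s) < hgt (take p s)" using * ab by blast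
    ultimately show False using ab(4) by simp
  qed
next
  assume nr: "\<not> in_reducible s p"
  show "\<forall>b. p < b \<and> b \<le> length s \<longrightarrow> hgt (take b s) < hgt (take p s)"
  proof (rule ccontr)
    assume "\<not> ?thesis"
    then obtain b0 where b0: "p < b0 \<and> b0 \<le> length s \<and> hgt (take p s) \<le> hgt (take b0 s)" by (auto simp: not_less)
    let ?P = "\<lambda>b. p < b \<and> b \<le> length s \<and> hgt (take p s) \<le> hgt (take b s)"
    define b where "b = (LEAST b. ?P b)"
    have b: "?P b" unfolding b_def by (rule LeastI[of ?P, OF b0])
    have least: "b \<le> x" if "?P x" for x unfolding b_def by (rule Least_le[of ?P, OF that])
    obtain x where x: "b = Suc x" using b by (cases b) auto
    have hp: "hgt (take (Suc p) s) = hgt (take p s) - 1" using hgt_take_Suc[OF p(1)] p(2) by simp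
    have "x \<noteq> p" using b hp x by auto
    then have px: "p < x" using b x by simp
    have "\<not> ?P x" using least[of x] x by auto
    then have "hgt (take x s) < hgt (take p s)" using px b x by simp
    moreover have "hgt (take b s) \<le> hgt (take x s) + 1" using hgt_take_Suc[of x s] b x by simp
    ultimately have eq: "hgt (take b s) = hgt (take p s)" using b by simp
    have "hgt (take y s) \<le> hgt (take p s)" if "p \<le> y" "y \<le> b" for y
    proof (cases "y = p \<or> y = b")
      case False
      then have "\<not> ?P y" using least[of y] that by auto
      then show ?thesis using that False b by simp
    qed (use eq in auto)
    then have "in_reducible s p" unfolding in_reducible_iff
      using b eq by (intro exI[of _ p] exI[of _ b]) simp
    then show False using nr by simp
  qed
qed

section \<open>Reading the signature column by column\<close>

definition colsigns :: "(nat \<Rightarrow> bool) \<Rightarrow> (nat \<Rightarrow> bool) \<Rightarrow> nat \<Rightarrow> (nat \<times> bool) list" where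
  "colsigns A R c = (if A c then [(c, True)] else []) @ (if R c then [(c, False)] else [])"

definition colhgt :: "(nat \<Rightarrow> bool) \<Rightarrow> (nat \<Rightarrow> bool) \<Rightarrow> nat \<Rightarrow> int" where
  "colhgt A R c = hgt (map snd (concat (map (colsigns A R) [1..<Suc c])))"

lemma colhgt_0: "colhgt A R 0 = 0"
  by (simp add: colhgt_def)

lemma colhgt_Suc:
  "colhgt A R (Suc c) = colhgt A R c + (if A (Suc c) then 1 else 0) - (if R (Suc c) then 1 else 0)"
  by (simp add: colhgt_def colsigns_def)

lemma column_of_position:
  assumes "\<And>c. \<not> (A c \<and> R c)" and "p < length (concat (map (colsigns A R) [1..<N]))"
  shows "\<exists>c x. concat (map (colsigns A R) [1..<N]) ! p = (c, x) \<and> 1 \<le> c \<and> c < N \<and> colsigns A R c = [(c, x)] \<and>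
    take p (concat (map (colsigns A R) [1..<N])) = concat (map (colsigns A R) [1..<c])"
  using assms(2)
proof (induction N)
  case (Suc N)
  let ?s = "concat (map (colsigns A R) [1..<N])"
  show ?case
  proof (cases "p < length ?s")
    case True
    then obtain c x where "?s ! p = (c, x)" "1 \<le> c" "c < N" "colsigns A R c = [(c, x)]"
      "take p ?s = concat (map (colsigns A R) [1..<c])" using Suc.IH by blast
    then show ?thesis using True by (intro exI[of _ c] exI[of _ x]) (auto simp: nth_append)
  next
    case False
    have N: "1 \<le> N" using Suc.prems by (cases "1 \<le> N") auto
    have "colsigns A R N \<noteq> []" using False Suc.prems N by auto
    then obtain x where x: "colsigns A R N = [(N, x)]"
      using assms(1)[of N] by (cases "A N"; cases "R N") (auto simp: colsigns_def)
    then have "p = length ?s" using False Suc.prems N by simp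
    then show ?thesis using x N by (intro exI[of _ N] exI[of _ x]) simp
  qed
qed simp

lemma column_prefix:
  assumes "c < N"
  shows "concat (map (colsigns A R) [1..<Suc c]) =
    take (length (concat (map (colsigns A R) [1..<Suc c]))) (concat (map (colsigns A R) [1..<N]))"
proof -
  have "[1..<N] = [1..<Suc c] @ [Suc c..<N]" using assms upt_add_eq_append[of 1 "Suc c" "N - Suc c"] by simp
  then show ?thesis by simp
qed

text \<open>The survival criteria with heights taken at column ends. Column 0 stands for the empty
  prefix, and N - 1 is the last column scanned.\<close>

definition survives :: "(nat \<Rightarrow> bool) \<Rightarrow> (nat \<Rightarrow> bool) \<Rightarrow> nat \<Rightarrow> nat \<times> bool \<Rightarrow> bool" where
  "survives A R N = (\<lambda>(c, x). if x then \<forall>a<c. colhgt A R a < colhgt A R c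
     else \<forall>d. c \<le> d \<and> d < N \<longrightarrow> colhgt A R d < colhgt A R (c - 1))"

text \<open>A column contributes at most one sign, so every prefix of the string consists of
  complete columns. Columns without a sign repeat the previous height; quantifying over columns or
  over positions thus gives the same conditions.\<close>

lemma survives_position:
  assumes AR: "\<And>c. \<not> (A c \<and> R c)" and s: "s = concat (map (colsigns A R) [1..<N])" and p: "p < length s"
  shows "\<not> in_reducible (map snd s) p \<longleftrightarrow> survives A R N (s ! p)"
proof -
  let ?pre = "\<lambda>c. concat (map (colsigns A R) [1..<Suc c])"
  obtain c x where c: "s ! p = (c, x)" "1 \<le> c" "c < N" "colsigns A R c = [(c, x)]"
    and tk: "take p s = concat (map (colsigns A R) [1..<c])"
    using column_of_position[where A = A and R = R and p = p and N = N] AR p unfolding s by blast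
  obtain d where d: "c = Suc d" using c by (cases c) auto
  have h: "hgt (take k (map snd s)) = hgt (map snd (take k s))" for k by (simp add: take_map)
  have hp: "hgt (take p (map snd s)) = colhgt A R d" using tk d by (simp only: h colhgt_def)
  have "take (Suc p) s = ?pre c"
    using tk c p by (simp add: take_Suc_conv_app_nth)
  then have hS: "hgt (take (Suc p) (map snd s)) = colhgt A R c" by (simp only: h colhgt_def)
  have len_mono: "length (?pre e) \<le> length (?pre e')" if "e \<le> e'" for e e'
  proof -
    have "[1..<Suc e'] = [1..<Suc e] @ [Suc e..<Suc e']"
      using that upt_add_eq_append[of 1 "Suc e" "e' - e"] by simp
    then show ?thesis by (simp del: upt_Suc)
  qed
  have len_d: "length (?pre d) = p" using tk d p by (metis length_take min.absorb2 less_imp_le)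
  have len_c: "length (?pre c) = Suc p"
    using \<open>take (Suc p) s = ?pre c\<close> p by (metis length_take min.absorb2 Suc_leI)
  have col_to_pos: "take (length (?pre e)) s = ?pre e \<and> length (?pre e) \<le> length s \<and>
      (e < c \<longrightarrow> length (?pre e) \<le> p) \<and> (c \<le> e \<longrightarrow> p < length (?pre e))" if e: "e < N" for e
  proof -
    have "take (length (?pre e)) s = ?pre e" using column_prefix[OF e] s by metis
    moreover from this have "length (?pre e) \<le> length s" by (metis length_take min.cobounded1)
    moreover have "length (?pre e) \<le> p" if "e < c" using len_mono[of e d] len_d d that by simp
    moreover have "p < length (?pre e)" if "c \<le> e" using len_mono[of c e] len_c that by linarith
    ultimately show ?thesis by blast
  qed
  \<comment> \<open>Several columns may give the same prefix. Any of them will do, since the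
    comparison with c follows from the lengths of prefixes.\<close>
  have pos_to_col: "\<exists>e. e < N \<and> take k s = ?pre e \<and> (k \<le> p \<longrightarrow> e < c) \<and> (p < k \<longrightarrow> c \<le> e)"
    if k: "k \<le> length s" for k
  proof -
    have "\<exists>e. e < N \<and> take k s = ?pre e"
    proof (cases "k = length s")
      case True
      then have "take k s = ?pre (N - 1)" using s c by simp
      then show ?thesis using c by (intro exI[of _ "N - 1"]) simp
    next
      case False
      then obtain e where "1 \<le> e" "e < N" "take k s = concat (map (colsigns A R) [1..<e])"
        using column_of_position[where A = A and R = R and p = k and N = N] AR k unfolding s by fastforce
      then show ?thesis by (intro exI[of _ "e - 1"]) simp
    qed
    then obtain e where e: "e < N" "take k s = ?pre e" by blast
    then have "k = length (?pre e)" using k by (metis length_take min.absorb2)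
    then show ?thesis using col_to_pos[OF e(1)] e by (metis not_less)
  qed
  show ?thesis
  proof (cases x)
    case True
    then have "\<not> in_reducible (map snd s) p \<longleftrightarrow> (\<forall>a\<le>p. hgt (take a (map snd s)) < colhgt A R c)"
      using plus_survives_iff[of p "map snd s"] p c hS by simp
    also have "\<dots> \<longleftrightarrow> (\<forall>a<c. colhgt A R a < colhgt A R c)"
    proof (intro iffI allI impI)
      fix a assume *: "\<forall>a\<le>p. hgt (take a (map snd s)) < colhgt A R c" and a: "a < c"
      obtain k where k: "k \<le> p" "take k s = ?pre a" using col_to_pos[of a] a c(3) by fastforce
      have "hgt (take k (map snd s)) = colhgt A R a" by (simp only: h k colhgt_def)
      then show "colhgt A R a < colhgt A R c" using * k by metis
    next
      fix k assume *: "\<forall>a<c. colhgt A R a < colhgt A R c" and k: "k \<le> p"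
      obtain e where e: "e < c" "take k s = ?pre e" using pos_to_col[of k] k p by auto
      have "hgt (take k (map snd s)) = colhgt A R e" by (simp only: h e colhgt_def)
      then show "hgt (take k (map snd s)) < colhgt A R c" using * e by metis
    qed
    finally show ?thesis using c True by (simp add: survives_def)
  next
    case False
    then have "\<not> in_reducible (map snd s) p \<longleftrightarrow>
      (\<forall>b. p < b \<and> b \<le> length s \<longrightarrow> hgt (take b (map snd s)) < colhgt A R d)"
      using minus_survives_iff[of p "map snd s"] p c hp by simp
    also have "\<dots> \<longleftrightarrow> (\<forall>e. c \<le> e \<and> e < N \<longrightarrow> colhgt A R e < colhgt A R d)"
    proof (intro iffI allI impI)
      fix e assume *: "\<forall>b. p < b \<and> b \<le> length s \<longrightarrow> hgt (take b (map snd s)) < colhgt A R d" and e: "c \<le> e \<and> e < N"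
      obtain k where k: "p < k" "k \<le> length s" "take k s = ?pre e" using col_to_pos[of e] e by blast
      have "hgt (take k (map snd s)) = colhgt A R e" by (simp only: h k colhgt_def)
      then show "colhgt A R e < colhgt A R d" using * k by metis
    next
      fix k assume *: "\<forall>e. c \<le> e \<and> e < N \<longrightarrow> colhgt A R e < colhgt A R d" and k: "p < k \<and> k \<le> length s"
      obtain e where e: "c \<le> e" "e < N" "take k s = ?pre e" using pos_to_col[of k] k by auto
      have "hgt (take k (map snd s)) = colhgt A R e" by (simp only: h e colhgt_def)
      then show "hgt (take k (map snd s)) < colhgt A R d" using * e by metis
    qed
    finally show ?thesis using c False d by (simp add: survives_def)
  qed
qed

lemma reduction_columns:
  assumes AR: "\<And>c. \<not> (A c \<and> R c)"
  shows "reduction (concat (map (colsigns A R) [1..<N])) =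
    filter (survives A R N) (concat (map (colsigns A R) [1..<N]))"
proof -
  define s where "s = concat (map (colsigns A R) [1..<N])"
  have "reduction s = map (\<lambda>p. s ! p) (filter (survives A R N \<circ> (\<lambda>p. s ! p)) [0..<length s])"
    unfolding reduction_def
    by (intro arg_cong[where f = "map _"] filter_cong refl)
      (use survives_position[where A = A and R = R and N = N] AR s_def in auto)
  also have "\<dots> = filter (survives A R N) (map (\<lambda>p. s ! p) [0..<length s])" by (simp only: filter_map)
  also have "\<dots> = filter (survives A R N) s" by (simp only: map_nth)
  finally show ?thesis by (simp only: s_def)
qed

text \<open>The left-hand side is the form to which the list comprehension in \<open>cf\<close>
  unfolds.\<close>

lemma plus_columns_filter:
  "concat (map (\<lambda>(c, x). if x then [c] else []) (filter S (concat (map (colsigns A R) cs)))) =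
    filter (\<lambda>c. A c \<and> S (c, True)) cs"
  by (induction cs) (auto simp: colsigns_def)

lemma minus_columns_filter:
  "concat (map (\<lambda>(c, x). if \<not> x then [c] else []) (filter S (concat (map (colsigns A R) cs)))) =
    filter (\<lambda>c. R c \<and> S (c, False)) cs"
  by (induction cs) (auto simp: colsigns_def)

lemma last_filter_upt:
  assumes "P c" "a \<le> c" "c < b" "\<And>d. c < d \<Longrightarrow> d < b \<Longrightarrow> \<not> P d"
  shows "filter P [a..<b] \<noteq> []" "last (filter P [a..<b]) = c"
proof -
  have "[a..<b] = [a..<c] @ c # [Suc c..<b]"
    using assms(2,3) upt_add_eq_append[of a c "b - c"] upt_conv_Cons[of c b] by simp
  moreover have "filter P [Suc c..<b] = []" using assms(4) by (simp add: filter_empty_conv)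
  ultimately have "filter P [a..<b] = filter P [a..<c] @ [c]" using assms(1) by simp
  then show "filter P [a..<b] \<noteq> []" "last (filter P [a..<b]) = c" by simp_all
qed

lemma hd_filter_upt:
  assumes "P c" "a \<le> c" "c < b" "\<And>d. a \<le> d \<Longrightarrow> d < c \<Longrightarrow> \<not> P d"
  shows "filter P [a..<b] \<noteq> []" "hd (filter P [a..<b]) = c"
proof -
  have "[a..<b] = [a..<c] @ c # [Suc c..<b]"
    using assms(2,3) upt_add_eq_append[of a c "b - c"] upt_conv_Cons[of c b] by simp
  moreover have "filter P [a..<c] = []" using assms(4) by (simp add: filter_empty_conv)
  ultimately have "filter P [a..<b] = c # filter P [Suc c..<b]" using assms(1) by simp
  then show "filter P [a..<b] \<noteq> []" "hd (filter P [a..<b]) = c" by simp_all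
qed

section \<open>The signature of a ladder sequence\<close>

text \<open>The bounds on c single out the columns with height + c = q + 1, called group q below: an
  added box lies on antidiagonal q + 1 and has label q mod 2, a removed one has the other label.
  Neighbouring columns of different groups have equal heights; hence the first column of a group is
  not addable, unless it is column 1, and the last one is not removable.\<close>

locale ladder_signature =
  fixes l :: "nat \<Rightarrow> nat" and A R :: "nat \<Rightarrow> bool" and i :: nat
  assumes ladder: "ladder l" and i: "i < 2"
    and A_iff: "q - l q < c \<Longrightarrow> c \<le> Suc q - l (Suc q) \<Longrightarrow>
      A c \<longleftrightarrow> q mod 2 = i \<and> (c = 1 \<or> q - l q < c - 1)"
    and R_iff: "q - l q < c \<Longrightarrow> c \<le> Suc q - l (Suc q) \<Longrightarrow>
      R c \<longleftrightarrow> q mod 2 \<noteq> i \<and> c < Suc q - l (Suc q)"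
begin

abbreviation E :: "nat \<Rightarrow> nat" where "E q \<equiv> q - l q"

abbreviation H :: "nat \<Rightarrow> int" where "H \<equiv> colhgt A R"

lemma E_Suc_less: "0 < E q \<Longrightarrow> E q < E (Suc q)"
  using ladder_step[OF ladder, of q] by simp

lemma E_Suc_le: "E q \<le> E (Suc q)"
  using E_Suc_less[of q] by (cases "E q = 0") simp_all

lemma E_mono: "p \<le> q \<Longrightarrow> E p \<le> E q"
  by (rule lift_Suc_mono_le[of E, OF E_Suc_le])

lemma int_E: "int (E q) = int q - int (l q)"
  using ladder_le[OF ladder, of q] by simp

lemma H_up:
  assumes q: "q mod 2 = i" and c: "Suc (E q) \<le> c" "c \<le> E (Suc q)"
  shows "H c = H (E q) + int c - int (E q) - (if E q = 0 then 0 else 1)"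
  using c
proof (induction c rule: dec_induct)
  case base
  then show ?case using A_iff[of q "Suc (E q)"] R_iff[of q "Suc (E q)"] q by (simp add: colhgt_Suc)
next
  case (step c)
  then show ?case using A_iff[of q "Suc c"] R_iff[of q "Suc c"] q by (simp add: colhgt_Suc)
qed

lemma H_down:
  assumes q: "q mod 2 \<noteq> i" and c: "Suc (E q) \<le> c" "c \<le> E (Suc q)"
  shows "H c = H (E q) - int c + int (E q) + (if c = E (Suc q) then 1 else 0)"
  using c
proof (induction c rule: dec_induct)
  case base
  then show ?case using A_iff[of q "Suc (E q)"] R_iff[of q "Suc (E q)"] q by (auto simp: colhgt_Suc)
next
  case (step c)
  then show ?case using A_iff[of q "Suc c"] R_iff[of q "Suc c"] q by (auto simp: colhgt_Suc)
qed

text \<open>Passing from q to q + 2, group q contributes minus signs and group q + 1 plus signs. The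
  last column of the former and the first of the latter carry no sign, and these corrections cancel.
  What remains is the second difference of E, which is the recursion of \<open>peak\<close>.\<close>

lemma H_peak: "q mod 2 \<noteq> i \<Longrightarrow> H (E q) = peak l q"
proof (induction q rule: induct_nat_012)
  case 0
  show ?case by (simp add: colhgt_0)
next
  case 1
  then have "i = 0" using i by auto
  then have "H (E 1) = int (E 1)" if "E 1 \<noteq> 0"
    using H_up[of 0 "E 1"] that by (simp add: colhgt_0)
  then show ?case using int_E[of 1] by (cases "E 1 = 0") (simp_all add: colhgt_0)
next
  case (ge2 q)
  have p: "Suc q mod 2 = i" "q mod 2 \<noteq> i" using ge2.prems i by presburger+
  have IH: "H (E q) = peak l q" using ge2.IH(1)[OF p(2)] .
  have pk: "peak l (Suc (Suc q)) = peak l q + int (E (Suc (Suc q))) - 2 * int (E (Suc q)) + int (E q)"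
    unfolding int_E by simp
  show ?case
  proof (cases "E (Suc q) = 0")
    case True
    \<comment> \<open>Group q is empty here, and group q + 1 can only start at column 1, which is
      exempt from the exception for first columns: again no correction is left.\<close>
    then have "E q = 0" using E_Suc_le[of q] by linarith
    moreover have "H (E (Suc (Suc q))) = H 0 + int (E (Suc (Suc q)))"
      using H_up[OF p(1), of "E (Suc (Suc q))"] True by (cases "E (Suc (Suc q)) = 0") simp_all
    ultimately show ?thesis using IH pk True by simp
  next
    case False
    have lt: "E q < E (Suc q)" using E_Suc_less[of q] False by (cases "E q = 0") simp_all
    have lt': "E (Suc q) < E (Suc (Suc q))" using E_Suc_less[of "Suc q"] False by simp
    have "H (E (Suc q)) = H (E q) - int (E (Suc q)) + int (E q) + 1"
      using H_down[OF p(2), of "E (Suc q)"] lt by simp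
    moreover have "H (E (Suc (Suc q))) = H (E (Suc q)) + int (E (Suc (Suc q))) - int (E (Suc q)) - 1"
      using H_up[OF p(1), of "E (Suc (Suc q))"] lt' False by simp
    ultimately show ?thesis using IH pk by linarith
  qed
qed

lemma column_group:
  assumes "1 \<le> c"
  obtains k where "E k < c" "c \<le> E (Suc k)"
proof -
  obtain B where B: "\<And>q. B < q \<Longrightarrow> l q = 0" using ladder_finite_support[OF ladder] by blast
  have ex: "c \<le> E (Suc (B + c))" using B[of "Suc (B + c)"] by simp
  define k where "k = (LEAST k. c \<le> E (Suc k))"
  have k: "c \<le> E (Suc k)" unfolding k_def by (rule LeastI[of "\<lambda>k. c \<le> E (Suc k)", OF ex])
  have "E k < c"
  proof (cases k)
    case 0 then show ?thesis using assms by simp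
  next
    case (Suc j)
    then have "\<not> c \<le> E (Suc j)" using not_less_Least[of j "\<lambda>k. c \<le> E (Suc k)"] k_def by simp
    then show ?thesis using Suc by simp
  qed
  then show ?thesis using k that by blast
qed

text \<open>The analogue of \<open>lpath_up\<close> and \<open>lpath_down\<close>: heights are
  measured from a column E q with q mod 2 \<noteq> i, where the local maxima sit.\<close>

lemma H_up_peak:
  assumes "k mod 2 = i" "E k < c" "c \<le> E (Suc k)"
  shows "H c = peak l (Suc k) - int (E (Suc k)) + int c"
proof -
  have "Suc k mod 2 \<noteq> i" using assms(1) by (auto simp: mod_Suc)
  then have "H (E (Suc k)) = peak l (Suc k)" by (rule H_peak)
  then show ?thesis
    using H_up[OF assms(1), of c] H_up[OF assms(1), of "E (Suc k)"] assms(2,3) by simp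
qed

lemma H_down_peak:
  assumes "k mod 2 \<noteq> i" "E k < c" "c \<le> E (Suc k)"
  shows "H c = peak l k - int c + int (E k) + (if c = E (Suc k) then 1 else 0)"
  using H_down[OF assms(1), of c] H_peak[OF assms(1)] assms(2,3) by simp

lemma H_le_peak:
  assumes max: "\<And>p. p mod 2 \<noteq> i \<Longrightarrow> peak l p \<le> K"
  shows "H c \<le> max 0 K"
proof (cases "c = 0")
  case False
  then obtain k where k: "E k < c" "c \<le> E (Suc k)" using column_group[of c] by auto
  show ?thesis
  proof (cases "k mod 2 = i")
    case True
    then have "Suc k mod 2 \<noteq> i" by (auto simp: mod_Suc)
    then show ?thesis using H_up_peak[OF True k] max[of "Suc k"] k by linarith
  next
    case False
    then show ?thesis using H_down_peak[OF False k] max[of k] k by (simp split: if_splits)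
  qed
qed (simp add: colhgt_0)

context
  fixes q
  assumes q: "q mod 2 \<noteq> i" and max: "\<And>p. p mod 2 \<noteq> i \<Longrightarrow> peak l p \<le> peak l q"
begin

text \<open>One of the first two peaks has the admissible parity, and neither is negative.\<close>

lemma max_peak_nonneg: "0 \<le> peak l q"
proof (cases "i = 0")
  case True
  then show ?thesis using max[of 1] ladder_le[OF ladder, of 1] by simp
next
  case False
  then show ?thesis using max[of 0] by simp
qed

lemma H_le_max: "H c \<le> peak l q"
  using H_le_peak[OF max, of c] max_peak_nonneg by simp

text \<open>E q is the first column at which the height attains its maximum: earlier columns are
  bounded by smaller peaks or lie on the rise towards it, and a later record would have to exceed
  the maximum.\<close>

lemma last_plus_column:
  assumes least: "\<And>p. p mod 2 \<noteq> i \<Longrightarrow> p < q \<Longrightarrow> peak l p < peak l q" and pos: "0 < peak l q"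
  shows "1 \<le> E q" "A (E q)" "a < E q \<Longrightarrow> H a < H (E q)" "E q < c \<Longrightarrow> \<not> (\<forall>a<c. H a < H c)"
proof -
  have mod_eq: "p mod 2 \<noteq> i" if "p mod 2 = q mod 2" for p using that q by simp
  note rise = peak_rise[OF ladder pos least[OF mod_eq]]
  obtain k where k: "q = Suc k" using rise(1) gr0_implies_Suc by blast
  have ki: "k mod 2 = i" using q k i by (auto simp: mod_Suc split: if_splits)
  show E1: "1 \<le> E q" using rise(2) by simp
  \<comment> \<open>By the room from \<open>peak_rise\<close>, E q is either column 1 or not the
    first column of its group, so it is not the exceptional one.\<close>
  have gap: "E q = 1 \<or> E k < E q - 1"
  proof (cases "l k = k")
    case True then show ?thesis using E1 by (simp add: not_le) linarith
  next
    case False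
    then have "l q < l k" using rise(3) k by simp
    then show ?thesis using ladder_le[OF ladder, of k] k by linarith
  qed
  have Ek: "E k < E q" using gap E1 E_Suc_le[of k] E_Suc_less[of k] k by (cases "E k = 0") auto
  show "A (E q)" using A_iff[of k "E q"] ki gap Ek k by simp
  show "H a < H (E q)" if a: "a < E q"
  proof (cases "a = 0")
    case True then show ?thesis using pos H_peak[OF q] by (simp add: colhgt_0)
  next
    case False
    then obtain j where j: "E j < a" "a \<le> E (Suc j)" using column_group[of a] by auto
    have jq: "j < q"
    proof (rule ccontr)
      assume "\<not> j < q"
      then show False using E_mono[of q j] j a by simp
    qed
    show ?thesis
    proof (cases "j mod 2 = i")
      case True
      then have ne: "Suc j mod 2 \<noteq> i" by (auto simp: mod_Suc)
      show ?thesis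
      proof (cases "Suc j = q")
        case True
        then show ?thesis using H_up_peak[OF \<open>j mod 2 = i\<close> j] H_peak[OF q] a by simp
      next
        case False
        then have "peak l (Suc j) < peak l q" using least[OF ne] jq by simp
        then show ?thesis using H_up_peak[OF True j] H_peak[OF q] j by linarith
      qed
    next
      case False
      then have "H a \<le> peak l j" using H_down_peak[OF False j] j by (simp split: if_splits)
      then show ?thesis using least[OF False jq] H_peak[OF q] by linarith
    qed
  qed
  show "\<not> (\<forall>a<c. H a < H c)" if "E q < c"
    using H_le_max[of c] H_peak[OF q] that by (metis linorder_not_less)
qed

text \<open>After E q the height never regains the maximum, since all later peaks are smaller. For
  column E q + 1 to be removable its group needs one more column, which \<open>peak_fall\<close>
  guarantees.\<close>

lemma first_minus_column:
  assumes greatest: "\<And>p. p mod 2 \<noteq> i \<Longrightarrow> q < p \<Longrightarrow> peak l p < peak l q"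
  shows "R (Suc (E q))" "E q < d \<Longrightarrow> H d < H (E q)"
proof -
  have fall: "l (Suc q) < l q"
    using peak_fall[OF ladder] greatest[of "Suc (Suc q)"] q by simp
  then have gap: "Suc (E q) < E (Suc q)" using ladder_le[OF ladder, of q] by linarith
  then show "R (Suc (E q))" using R_iff[of q "Suc (E q)"] q by simp
  show "H d < H (E q)" if d: "E q < d"
  proof -
    obtain k where k: "E k < d" "d \<le> E (Suc k)" using column_group[of d] d by auto
    have kq: "q \<le> k"
    proof (rule ccontr)
      assume "\<not> q \<le> k"
      then show False using E_mono[of "Suc k" q] k d by simp
    qed
    show ?thesis
    proof (cases "k mod 2 = i")
      case True
      then have "Suc k mod 2 \<noteq> i" by (auto simp: mod_Suc)
      then have "peak l (Suc k) < peak l q" using greatest[of "Suc k"] kq by simp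
      then show ?thesis using H_up_peak[OF True k] H_peak[OF q] k by linarith
    next
      case False
      show ?thesis
      proof (cases "k = q")
        case True
        then show ?thesis using H_down_peak[OF False k] H_peak[OF q] gap k by (simp split: if_splits)
      next
        case ne: False
        have "H d \<le> peak l k" using H_down_peak[OF False k] k by (simp split: if_splits)
        then show ?thesis using greatest[OF False] ne kq H_peak[OF q] by simp
      qed
    qed
  qed
qed

end

end

lemma ladder_signature_partition:
  assumes r: "regular xs" and i: "i < 2"
  shows "ladder_signature (lad xs) (addable (xs, 0) i) (removable (xs, 0) i) i"
proof
  show "ladder (lad xs)" using ladder_lad[OF r] .
  show "i < 2" using i .
  fix q c
  assume c: "q - lad xs q < c" "c \<le> Suc q - lad xs (Suc q)"
  have c1: "1 \<le> c" using c by simp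
  define h where "h = colh xs c"
  have E: "d \<le> p - lad xs p \<longleftrightarrow> colh xs d + d \<le> p" if "1 \<le> d" for d p
    using le_colfill_iff[OF r that] .
  have C: "k \<le> colh xs d \<longleftrightarrow> d \<le> part xs k" if "1 \<le> k" "1 \<le> d" for k d
    using le_colh_iff[OF r that] .
  have h: "h + c = Suc q" using E[OF c1, of q] E[OF c1, of "Suc q"] c by (simp add: h_def)
  have "\<not> c \<le> part xs (h + 1)" using C[of "h + 1" c] c1 by (simp add: h_def)
  then have "part xs (h + 1) = c - 1 \<longleftrightarrow> c - 1 \<le> part xs (h + 1)" using c1 by auto
  also have "\<dots> \<longleftrightarrow> c = 1 \<or> q - lad xs q < c - 1"
  proof (cases "c = 1")
    case False
    then have c2: "1 \<le> c - 1" using c1 by simp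
    have "c - 1 \<le> part xs (h + 1) \<longleftrightarrow> h + 1 \<le> colh xs (c - 1)" using C[of "h + 1" "c - 1"] c2 by simp
    also have "\<dots> \<longleftrightarrow> \<not> colh xs (c - 1) + (c - 1) \<le> q" using h c2 by linarith
    also have "\<dots> \<longleftrightarrow> q - lad xs q < c - 1" unfolding E[OF c2, symmetric] by (rule not_le)
    finally show ?thesis using False by simp
  qed simp
  finally have a: "part xs (h + 1) = c - 1 \<longleftrightarrow> c = 1 \<or> q - lad xs q < c - 1" .
  have "label 0 (h + 1) c = q mod 2"
  proof -
    have "h + 1 + c = q + 2" using h by simp
    then show ?thesis by (simp add: label_0)
  qed
  then show "addable (xs, 0) i c \<longleftrightarrow> q mod 2 = i \<and> (c = 1 \<or> q - lad xs q < c - 1)"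
    using a c1 by (simp add: addable_def Let_def flip: h_def)
  have "1 \<le> h \<and> part xs h = c \<longleftrightarrow> c < Suc q - lad xs (Suc q)"
  proof (cases "1 \<le> h")
    case True
    have "c \<le> part xs h" using C[OF True c1] by (simp add: h_def)
    then have "part xs h = c \<longleftrightarrow> \<not> c + 1 \<le> part xs h" by auto
    also have "\<dots> \<longleftrightarrow> \<not> h \<le> colh xs (c + 1)" using C[OF True, of "c + 1"] by simp
    also have "\<dots> \<longleftrightarrow> colh xs (c + 1) + (c + 1) \<le> Suc q" using h by linarith
    also have "\<dots> \<longleftrightarrow> c + 1 \<le> Suc q - lad xs (Suc q)" using E[of "c + 1" "Suc q"] by simp
    finally show ?thesis using True by (simp add: Suc_le_eq)
  next
    case False
    then show ?thesis using h by auto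
  qed
  moreover have "label 0 h c = Suc q mod 2" using h by (simp add: label_0)
  moreover have "Suc q mod 2 = i \<longleftrightarrow> q mod 2 \<noteq> i" using i by presburger
  ultimately show "removable (xs, 0) i c \<longleftrightarrow> q mod 2 \<noteq> i \<and> c < Suc q - lad xs (Suc q)"
    using c1 by (auto simp: removable_def Let_def simp flip: h_def)
qed

text \<open>The box to be added and the box to be removed are vertical neighbours, so their labels
  differ.\<close>

lemma not_addable_removable: "\<not> (addable (xs, 0) i c \<and> removable (xs, 0) i c)"
proof
  assume "addable (xs, 0) i c \<and> removable (xs, 0) i c"
  then have "label 0 (colh xs c + 1) c = label 0 (colh xs c) c"
    by (auto simp: addable_def removable_def Let_def)
  then show False unfolding label_0 by presburger
qed

lemma addable_bound:
  assumes "regular xs" "addable (xs, 0) i c"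
  shows "1 \<le> c" "c < part xs 1 + 2"
proof -
  have a: "1 \<le> c" "part xs (colh xs c + 1) = c - 1" using assms(2) by (auto simp: addable_def Let_def)
  then show "1 \<le> c" by simp
  show "c < part xs 1 + 2" using part_antimono[OF assms(1), of 1 "colh xs c + 1"] a by simp
qed

lemma removable_bound:
  assumes "regular xs" "removable (xs, 0) i c"
  shows "1 \<le> c" "c < part xs 1 + 1"
proof -
  have a: "1 \<le> c" "1 \<le> colh xs c" "part xs (colh xs c) = c" using assms(2) by (auto simp: removable_def Let_def)
  then show "1 \<le> c" by simp
  show "c < part xs 1 + 1" using part_antimono[OF assms(1), of 1 "colh xs c"] a by simp
qed

lemma reduced_signature_filter:
  "reduced_signature (xs, 0) i =
    filter (survives (addable (xs, 0) i) (removable (xs, 0) i) (part xs 1 + 2))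
      (concat (map (colsigns (addable (xs, 0) i) (removable (xs, 0) i)) [1..<part xs 1 + 2]))"
proof -
  have sig: "signature (xs, 0) i = concat (map (colsigns (addable (xs, 0) i) (removable (xs, 0) i)) [1..<part xs 1 + 2])"
    unfolding signature_def fst_conv by (intro arg_cong[where f = concat] map_cong refl) (simp add: colsigns_def)
  show ?thesis
    unfolding reduced_signature_def sig by (rule reduction_columns) (rule not_addable_removable)
qed

lemma cf_columns:
  fixes xs i
  defines "A \<equiv> addable (xs, 0) i" and "R \<equiv> removable (xs, 0) i"
  shows "cf i (xs, 0) = (let ps = filter (\<lambda>c. A c \<and> (\<forall>a<c. colhgt A R a < colhgt A R c)) [1..<part xs 1 + 2]
     in if ps = [] then None else Some (add_box xs (last ps), 0))"
proof -
  have "concat (map (\<lambda>(c, s). if s then [c] else []) (reduced_signature (xs, 0) i)) =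
    filter (\<lambda>c. A c \<and> (\<forall>a<c. colhgt A R a < colhgt A R c)) [1..<part xs 1 + 2]"
    unfolding reduced_signature_filter plus_columns_filter A_def R_def by (simp add: survives_def)
  then show ?thesis unfolding cf_def by simp
qed

lemma ce_columns:
  fixes xs i
  defines "A \<equiv> addable (xs, 0) i" and "R \<equiv> removable (xs, 0) i"
  shows "ce i (xs, 0) = (let ms = filter (\<lambda>c. R c \<and>
      (\<forall>d. c \<le> d \<and> d < part xs 1 + 2 \<longrightarrow> colhgt A R d < colhgt A R (c - 1))) [1..<part xs 1 + 2]
     in if ms = [] then None else Some (remove_box xs (hd ms), 0))"
proof -
  have "concat (map (\<lambda>(c, s). if \<not> s then [c] else []) (reduced_signature (xs, 0) i)) =
    filter (\<lambda>c. R c \<and> (\<forall>d. c \<le> d \<and> d < part xs 1 + 2 \<longrightarrow> colhgt A R d < colhgt A R (c - 1))) [1..<part xs 1 + 2]"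
    unfolding reduced_signature_filter minus_columns_filter A_def R_def by (simp add: survives_def)
  then show ?thesis unfolding ce_def by simp
qed

section \<open>Compatibility with the root operators\<close>

lemma Psi_cf:
  assumes r: "regular xs" and i: "i < 2"
  shows "(\<forall>b'. cf i (xs, 0) = Some b' \<longrightarrow> b' \<in> Y 0) \<and> map_option Psi (cf i (xs, 0)) = pf i (Psi (xs, 0))"
proof -
  define A where "A = addable (xs, 0) i"
  define R where "R = removable (xs, 0) i"
  define N where "N = part xs 1 + 2"
  let ?l = "lad xs" and ?H = "colhgt A R"
  let ?P = "\<lambda>c. A c \<and> (\<forall>a<c. ?H a < ?H c)"
  interpret ladder_signature ?l A R i
    using ladder_signature_partition[OF r i] by (simp add: A_def R_def)
  have cf: "cf i (xs, 0) = (let ps = filter ?P [1..<N]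
     in if ps = [] then None else Some (add_box xs (last ps), 0))"
    unfolding A_def R_def N_def by (rule cf_columns)
  obtain q0 where q0: "q0 mod 2 \<noteq> i" "\<And>p. p mod 2 \<noteq> i \<Longrightarrow> peak ?l p \<le> peak ?l q0"
    using peak_attains_max[OF ladder i] by blast
  show ?thesis
  proof (cases "0 < peak ?l q0")
    case False
    then have le0: "peak ?l p \<le> 0" if "p mod 2 \<noteq> i" for p using q0(2)[OF that] by simp
    \<comment> \<open>A record has to exceed the height 0 before the first column, and no height
      does so when all peaks are at most 0.\<close>
    have "\<not> ?P c" if "1 \<le> c" for c
    proof
      assume "?P c"
      then have "?H 0 < ?H c" using that by simp
      then show False using H_le_peak[OF le0, of c] by (simp add: colhgt_0)
    qed
    then have "filter ?P [1..<N] = []" by (simp add: filter_empty_conv)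
    then have "cf i (xs, 0) = None" using cf by simp
    then show ?thesis using pf_lpath_None[OF ladder i le0] Psi_eq_lpath[OF r] by simp
  next
    case True
    define q where "q = (LEAST q. q mod 2 \<noteq> i \<and> peak ?l q = peak ?l q0)"
    have q: "q mod 2 \<noteq> i \<and> peak ?l q = peak ?l q0"
      unfolding q_def by (rule LeastI[of _ q0]) (use q0 in simp)
    have max: "peak ?l p \<le> peak ?l q" if "p mod 2 \<noteq> i" for p using q0(2)[OF that] q by simp
    have least: "peak ?l p < peak ?l q" if "p mod 2 \<noteq> i" "p < q" for p
    proof -
      have "peak ?l p \<noteq> peak ?l q0" using not_less_Least[of p "\<lambda>q. q mod 2 \<noteq> i \<and> peak ?l q = peak ?l q0"] that q_def by blast
      then show ?thesis using max[OF that(1)] q by simp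
    qed
    have pos: "0 < peak ?l q" using True q by simp
    have qi: "q mod 2 \<noteq> i" using q by simp
    have col: "1 \<le> E q" "A (E q)" using last_plus_column(1,2)[OF qi max least pos] by blast+
    have mod_eq: "p mod 2 \<noteq> i" if "p mod 2 = q mod 2" for p using that qi by simp
    have rise: "?l q < q" "?l q < ?l (q - 1) \<or> ?l (q - 1) = q - 1"
      using peak_rise(2,3)[OF ladder pos least[OF mod_eq]] by blast+
    have "?P (E q)" using col(2) last_plus_column(3)[OF qi max least pos] by blast
    moreover have "E q < N" using addable_bound[OF r, of i] col(2) by (simp add: A_def N_def)
    moreover have "\<not> ?P d" if "E q < d" for d
      using last_plus_column(4)[OF qi max least pos] that by blast
    ultimately have "filter ?P [1..<N] \<noteq> []" "last (filter ?P [1..<N]) = E q"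
      using last_filter_upt[of ?P "E q" 1 "N"] col(1) by blast+
    then have cfS: "cf i (xs, 0) = Some (add_box xs (E q), 0)" using cf by simp
    have ab: "regular (add_box xs (E q))" "lad (add_box xs (E q)) = ?l(q := ?l q + 1)"
      using add_box_ladder[OF r rise] by auto
    have "pf i (Psi (xs, 0)) = Some (lpath (?l(q := ?l q + 1)))"
      using pf_lpath_Some[OF ladder i qi max least pos] Psi_eq_lpath[OF r] by simp
    then show ?thesis using cfS ab Psi_eq_lpath[OF ab(1)] by (simp add: Y_def)
  qed
qed

lemma Psi_ce:
  assumes r: "regular xs" and i: "i < 2"
  shows "(\<forall>b'. ce i (xs, 0) = Some b' \<longrightarrow> b' \<in> Y 0) \<and> map_option Psi (ce i (xs, 0)) = pe i (Psi (xs, 0))"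
proof -
  define A where "A = addable (xs, 0) i"
  define R where "R = removable (xs, 0) i"
  define N where "N = part xs 1 + 2"
  let ?l = "lad xs" and ?H = "colhgt A R"
  let ?P = "\<lambda>c. R c \<and> (\<forall>d. c \<le> d \<and> d < N \<longrightarrow> ?H d < ?H (c - 1))"
  interpret ladder_signature ?l A R i
    using ladder_signature_partition[OF r i] by (simp add: A_def R_def)
  have ce: "ce i (xs, 0) = (let ms = filter ?P [1..<N]
     in if ms = [] then None else Some (remove_box xs (hd ms), 0))"
    unfolding A_def R_def N_def by (rule ce_columns)
  obtain q0 where q0: "q0 mod 2 \<noteq> i" "\<And>p. p mod 2 \<noteq> i \<Longrightarrow> peak ?l p \<le> peak ?l q0"
    using peak_attains_max[OF ladder i] by blast
  obtain B where B: "\<And>q. B < q \<Longrightarrow> ?l q = 0" using ladder_finite_support[OF ladder] by blast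
  let ?S = "{q. q mod 2 \<noteq> i \<and> peak ?l q = peak ?l q0}"
  show ?thesis
  \<comment> \<open>If the maximal peak recurs beyond the support of l, it is the final height, so
    no minus survives and both operators give \<open>None\<close>. Otherwise only finitely many
    indices attain it, and there is a greatest one.\<close>
  proof (cases "\<exists>q \<in> ?S. B < q")
    case True
    then obtain q where q: "q mod 2 \<noteq> i" "peak ?l q = peak ?l q0" "B < q" by blast
    have max: "peak ?l p \<le> peak ?l q" if "p mod 2 \<noteq> i" for p using q0(2)[OF that] q by simp
    have const: "?H (N - 1 + j) = ?H (N - 1)" for j
    proof (induction j)
      case (Suc j)
      have "\<not> A (Suc (N - 1 + j))" "\<not> R (Suc (N - 1 + j))"
        using addable_bound(2)[OF r, of i "Suc (N - 1 + j)"] removable_bound(2)[OF r, of i "Suc (N - 1 + j)"]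
        by (auto simp: A_def R_def N_def)
      then show ?case using Suc by (simp add: colhgt_Suc)
    qed simp
    \<comment> \<open>So far out that E p = p lies beyond the last column scanned, where the height
      is constant; the height at the end of the signature is therefore the maximum.\<close>
    define p where "p = q + 2 * N"
    have "peak ?l p = peak ?l q" using peak_eventually_const[of B ?l q p] B q by (simp add: p_def)
    moreover have "p mod 2 \<noteq> i" using q by (simp add: p_def)
    moreover have "E p = N - 1 + (p + 1 - N)" using B[of p] q by (simp add: p_def N_def)
    ultimately have last: "?H (N - 1) = peak ?l q" using H_peak[of p] const by metis
    have "\<not> ?P c" if "1 \<le> c" "c < N" for c
    proof
      assume "?P c"
      moreover have "c \<le> N - 1 \<and> N - 1 < N" using that by auto
      ultimately have "?H (N - 1) < ?H (c - 1)" by blast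
      then show False using H_le_max[OF q(1) max, of "c - 1"] last by simp
    qed
    then have "filter ?P [1..<N] = []" by (simp add: filter_empty_conv)
    then have "ce i (xs, 0) = None" using ce by simp
    moreover have "pe i (lpath ?l) = None"
      by (rule pe_lpath_None[OF ladder i q(1) max]) (use B q in auto)
    ultimately show ?thesis using Psi_eq_lpath[OF r] by simp
  next
    case False
    then have "?S \<subseteq> {..B}" by (auto simp: not_less)
    then have fin: "finite ?S" by (rule finite_subset) simp
    have ne: "?S \<noteq> {}" using q0(1) by blast
    define q where "q = Max ?S"
    have q: "q mod 2 \<noteq> i \<and> peak ?l q = peak ?l q0" using Max_in[OF fin ne] by (simp add: q_def)
    have max: "peak ?l p \<le> peak ?l q" if "p mod 2 \<noteq> i" for p using q0(2)[OF that] q by simp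
    have greatest: "peak ?l p < peak ?l q" if "p mod 2 \<noteq> i" "q < p" for p
    proof -
      have "p \<notin> ?S" using Max_ge[OF fin, of p] that(2) by (auto simp: q_def)
      then show ?thesis using max[OF that(1)] q that(1) by simp
    qed
    have qi: "q mod 2 \<noteq> i" using q by simp
    note col = first_minus_column[OF qi max greatest]
    have bound: "Suc (E q) < N" using removable_bound(2)[OF r, of i "Suc (E q)"] col(1) by (simp add: R_def N_def)
    have "?P (Suc (E q))" using col by simp
    \<comment> \<open>A surviving minus further left would force the maximal height at E q to lie
      strictly below an earlier height.\<close>
    moreover have "\<not> ?P c" if "1 \<le> c" "c < Suc (E q)" for c
    proof
      assume "?P c"
      moreover have "c \<le> E q \<and> E q < N" using that bound by simp
      ultimately have "?H (E q) < ?H (c - 1)" by blast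
      then show False using H_le_max[OF qi max, of "c - 1"] H_peak[OF qi] by simp
    qed
    ultimately have "filter ?P [1..<N] \<noteq> []" "hd (filter ?P [1..<N]) = Suc (E q)"
      using hd_filter_upt[of ?P "Suc (E q)" 1 N] bound by simp_all
    then have ceS: "ce i (xs, 0) = Some (remove_box xs (Suc (E q)), 0)" using ce by simp
    have "?l (Suc q) < ?l q" using peak_fall[OF ladder] greatest[of "Suc (Suc q)"] qi by simp
    then have rb: "regular (remove_box xs (Suc (E q)))" "lad (remove_box xs (Suc (E q))) = ?l(q := ?l q - 1)"
      using remove_box_ladder[OF r] by auto
    have "pe i (Psi (xs, 0)) = Some (lpath (?l(q := ?l q - 1)))"
      using pe_lpath_Some[OF ladder i qi max greatest] Psi_eq_lpath[OF r] by simp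
    then show ?thesis using ceS rb Psi_eq_lpath[OF rb(1)] by (simp add: Y_def)
  qed
qed

theorem mainTheorem1:
  shows "bij_betw Psi (Y 0) P_Lam0 \<and>
    (\<forall>b \<in> Y 0. pweight (Psi b) = cweight b) \<and>
    (\<forall>b \<in> Y 0. \<forall>i \<in> {0, 1}.
       (\<forall>b'. cf i b = Some b' \<longrightarrow> b' \<in> Y 0) \<and>
       map_option Psi (cf i b) = pf i (Psi b) \<and>
       (\<forall>b'. ce i b = Some b' \<longrightarrow> b' \<in> Y 0) \<and>
       map_option Psi (ce i b) = pe i (Psi b))"
proof (intro conjI ballI)
  show "bij_betw Psi (Y 0) P_Lam0" by (rule bij_betw_Psi)
next
  fix b assume "b \<in> Y 0"
  then show "pweight (Psi b) = cweight b" using Psi_weight by (auto simp: Y_def)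
next
  fix b and i :: nat assume "b \<in> Y 0" and "i \<in> {0, 1}"
  then obtain xs where b: "b = (xs, 0)" "regular xs" and i: "i < 2" by (auto simp: Y_def)
  show "\<forall>b'. cf i b = Some b' \<longrightarrow> b' \<in> Y 0" "map_option Psi (cf i b) = pf i (Psi b)"
    "\<forall>b'. ce i b = Some b' \<longrightarrow> b' \<in> Y 0" "map_option Psi (ce i b) = pe i (Psi b)"
    unfolding b(1) using Psi_cf[OF b(2) i] Psi_ce[OF b(2) i] by blast+
qed

end
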